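(* Let $A:\mathbb C^N\to L^\infty((\Omega\cup\Omega_\delta)^2;\mathbb C)$, $\hat{\boldsymbol\xi}\mapsto A(\cdot,\cdot,\hat{\boldsymbol\xi})$, be a holomorphic $L^\infty((\Omega\cup\Omega_\delta)^2)$-valued map (the complex continuation of the parametric diffusion coefficient), and assume there are $r_c,R_c\in\mathbb R$ such that $$0<r_c\le \mathrm{Re}\,A(\mathbf x,\mathbf y,\hat{\boldsymbol\xi})\le|A(\mathbf x,\mathbf y,\hat{\boldsymbol\xi})|\le R_c<\infty\qquad\text{for all }\hat{\boldsymbol\xi}\in\hat\Gamma .$$ Let $u^\delta(\cdot,\hat{\boldsymbol\xi})\in S_\delta(\Omega;\mathbb C)$ denote the weak solution of the nonlocal problem with coefficient $A(\cdot,\cdot,\hat{\boldsymbol\xi})$, right-hand side $f\in(S_\delta(\Omega;\mathbb C))^\ast$ and zero boundary datum. Then the function $\hat{\boldsymbol\xi}\mapsto u^\delta(\cdot,\hat{\boldsymbol\xi})$, with values in $S_\delta(\Omega;\mathbb C)$, is holomorphic in an open neighborhood of $\hat\Gamma$ in $\mathbb C^N$.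
   Context: $\Omega\subset\mathbb R^d$ ($d\ge1$) is a bounded Lipschitz domain; $\Omega_\delta=\{\mathbf x\in\mathbb R^d\setminus\Omega:\mathrm{dist}(\mathbf x,\partial\Omega)<\delta\}$; $B_\delta(\mathbf x)=\{\mathbf y:|\mathbf y-\mathbf x|<\delta\}$. $\Gamma=[-1,1]^N$, and $\hat\Gamma=\prod_{i=1}^N\{\hat\xi_{(i)}\in\mathbb C:|\hat\xi_{(i)}|\le1\}$. For real parameters $A(\mathbf x,\mathbf y,\boldsymbol\xi)$ is real and symmetric in $(\mathbf x,\mathbf y)$. Kernel (real valued): $\gamma_\delta(|\mathbf x-\mathbf y|)=\frac1{\delta^{d+2}}\gamma_1\!\left(\frac{|\mathbf x-\mathbf y|}{\delta}\right)$, equal to $\frac{D_0}{\delta^{d+2-s}|\mathbf x-\mathbf y|^s}$ for $|\mathbf x-\mathbf y|<\delta$ and $0$ otherwise ($D_0>0$), where $\gamma_1$ is nonnegative, nonincreasing, has a singularity of order $s$ at the origin, $\mathrm{supp}(\gamma_1)\subset B_1(\mathbf 0)$ and $\int_{B_1(\mathbf 0)}\gamma_1(|\mathbf z|)|\mathbf z|^2d\mathbf z=d$. $S_\delta(\Omega;\mathbb C)$ is the space of complex-valued $u\in L^2(\Omega\cup\Omega_\delta)$ with $u|_{\Omega_\delta}=0$ and finite norm $\|u\|^2_{S_\delta(\Omega;\mathbb C)}=\iint_{(\Omega\cup\Omega_\delta)^2}\gamma_\delta(|\mathbf y-\mathbf x|)|u(\mathbf y)-u(\mathbf x)|^2d\mathbf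 y\,d\mathbf x$; $(S_\delta(\Omega;\mathbb C))^\ast$ is its dual (conjugate-linear functionals) with induced norm. The weak problem for $\hat{\boldsymbol\xi}$: find $u\in S_\delta(\Omega;\mathbb C)$ with $$\iint_{(\Omega\cup\Omega_\delta)^2}A(\mathbf x,\mathbf y,\hat{\boldsymbol\xi})\gamma_\delta(|\mathbf x-\mathbf y|)(u(\mathbf y)-u(\mathbf x))\overline{(v(\mathbf y)-v(\mathbf x))}\,d\mathbf y\,d\mathbf x=\langle f,v\rangle\quad\forall v\in S_\delta(\Omega;\mathbb C),$$ uniquely solvable whenever $\mathrm{Re}\,A(\cdot,\cdot,\hat{\boldsymbol\xi})$ is bounded below by a positive constant. The horizon satisfies $0<\delta<\delta_0$, where $\delta_0>0$ is a constant for which the (known) nonlocal Poincaré inequality $\|v\|_{L^2(\Omega)}^2\le C\|v\|^2_{S_\delta(\Omega)}$ holds with one constant $C$ for all $0<\delta<\delta_0$. *)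

theory Defs
  imports "HOL-Probability.Essential_Supremum"
begin

text \<open>
  Elements of $L^2$, $L^\infty$ and of the nonlocal energy space are represented by Borel
  measurable functions; equality in these spaces is equality almost everywhere with respect
  to Lebesgue measure. A function representing a class on a set is unconstrained outside
  that set, so all operations on representatives are taken pointwise.
\<close>

text \<open>Near every boundary point the set is the strict epigraph, in the direction of some
  unit vector \<open>e\<close>, of a Lipschitz function on the hyperplane orthogonal to \<open>e\<close>.\<close>

definition bounded_lipschitz_domain :: "'a::euclidean_space set \<Rightarrow> bool" where
  "bounded_lipschitz_domain \<Omega> \<longleftrightarrow>
     \<Omega> \<noteq> {} \<and> open \<Omega> \<and> connected \<Omega> \<and> bounded \<Omega> \<and>
     (\<forall>p\<in>frontier \<Omega>. \<exists>r>0. \<exists>e \<phi> K. norm e = 1 \<and> K-lipschitz_on {y. y \<bullet> e = 0} \<phi> \<and>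
        \<Omega> \<inter> ball p r = {x \<in> ball p r. \<phi> (x - (x \<bullet> e) *\<^sub>R e) < x \<bullet> e})"

definition interaction_domain :: "'a::euclidean_space set \<Rightarrow> real \<Rightarrow> 'a set" where
  "interaction_domain \<Omega> \<delta> = {x. x \<notin> \<Omega> \<and> infdist x (frontier \<Omega>) < \<delta>}"

abbreviation extended_domain :: "'a::euclidean_space set \<Rightarrow> real \<Rightarrow> 'a set" where
  "extended_domain \<Omega> \<delta> \<equiv> \<Omega> \<union> interaction_domain \<Omega> \<delta>"

abbreviation extended_square :: "'a::euclidean_space set \<Rightarrow> real \<Rightarrow> ('a \<times> 'a) set" where
  "extended_square \<Omega> \<delta> \<equiv> extended_domain \<Omega> \<delta> \<times> extended_domain \<Omega> \<delta>"

text \<open>The radial profile \<open>\<gamma>\<^sub>1\<close> on $\mathbb{R}^d$. Its value at the origin is irrelevant.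
  Monotonicity forces \<open>s \<ge> 0\<close>, and the normalisation forces \<open>s < d + 2\<close>
  (a Bochner integral that diverges has the value 0); the degenerate case \<open>s = 0\<close> of a
  kernel without singularity is not excluded. The truncation at radius 1 includes the sphere,
  which is a null set.\<close>

definition kernel_profile :: "'a::euclidean_space itself \<Rightarrow> real \<Rightarrow> real \<Rightarrow> (real \<Rightarrow> real) \<Rightarrow> bool" where
  "kernel_profile _ D0 s \<gamma>1 \<longleftrightarrow>
     D0 > 0 \<and> (\<forall>r\<ge>0. \<gamma>1 r \<ge> 0) \<and> antimono_on {0<..} \<gamma>1 \<and>
     (\<forall>r. 0 < r \<and> r < 1 \<longrightarrow> \<gamma>1 r = D0 / r powr s) \<and> (\<forall>r\<ge>1. \<gamma>1 r = 0) \<and>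
     (LINT z:ball (0::'a) 1|lborel. \<gamma>1 (norm z) * (norm z)\<^sup>2) = real DIM('a)"

text \<open>\<open>scaled_kernel TYPE('a) \<gamma>1 \<delta>\<close> is \<open>\<gamma>\<^sub>\<delta>\<close>; for \<open>0 < r < \<delta>\<close> its value is
  \<open>D0 / (\<delta> powr (d + 2 - s) * r powr s)\<close>.\<close>

definition scaled_kernel :: "'a::euclidean_space itself \<Rightarrow> (real \<Rightarrow> real) \<Rightarrow> real \<Rightarrow> real \<Rightarrow> real" where
  "scaled_kernel _ \<gamma>1 \<delta> r = \<gamma>1 (r / \<delta>) / \<delta> ^ (DIM('a) + 2)"

definition nonlocal_density ::
  "(real \<Rightarrow> real) \<Rightarrow> real \<Rightarrow> ('a::euclidean_space \<Rightarrow> 'b::real_normed_vector) \<Rightarrow> 'a \<times> 'a \<Rightarrow> real" where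
  "nonlocal_density \<gamma>1 \<delta> u = (\<lambda>(x, y). scaled_kernel TYPE('a) \<gamma>1 \<delta> (norm (y - x)) * (norm (u y - u x))\<^sup>2)"

text \<open>The codomain \<open>real\<close> gives $S_\delta(\Omega)$ and \<open>complex\<close> gives $S_\delta(\Omega;\mathbb{C})$.\<close>

definition nonlocal_space :: "(real \<Rightarrow> real) \<Rightarrow> 'a::euclidean_space set \<Rightarrow> real \<Rightarrow>
    ('a \<Rightarrow> 'b::{real_normed_vector, second_countable_topology}) set" where
  "nonlocal_space \<gamma>1 \<Omega> \<delta> =
     {u. set_borel_measurable lborel (extended_domain \<Omega> \<delta>) u \<and>
         set_integrable lborel (extended_domain \<Omega> \<delta>) (\<lambda>x. (norm (u x))\<^sup>2) \<and>
         (AE x in lborel. x \<in> interaction_domain \<Omega> \<delta> \<longrightarrow> u x = 0) \<and>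
         set_integrable lborel (extended_square \<Omega> \<delta>) (nonlocal_density \<gamma>1 \<delta> u)}"

definition nonlocal_norm :: "(real \<Rightarrow> real) \<Rightarrow> 'a::euclidean_space set \<Rightarrow> real \<Rightarrow>
    ('a \<Rightarrow> 'b::real_normed_vector) \<Rightarrow> real" where
  "nonlocal_norm \<gamma>1 \<Omega> \<delta> u =
     sqrt (LINT p:extended_square \<Omega> \<delta>|lborel. nonlocal_density \<gamma>1 \<delta> u p)"

definition nonlocal_poincare :: "(real \<Rightarrow> real) \<Rightarrow> 'a::euclidean_space set \<Rightarrow> real \<Rightarrow> bool" where
  "nonlocal_poincare \<gamma>1 \<Omega> \<delta>0 \<longleftrightarrow>
     (\<exists>C. \<forall>\<delta>. 0 < \<delta> \<and> \<delta> < \<delta>0 \<longrightarrow>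
        (\<forall>v :: 'a \<Rightarrow> real. v \<in> nonlocal_space \<gamma>1 \<Omega> \<delta> \<longrightarrow>
           (LINT x:\<Omega>|lborel. (norm (v x))\<^sup>2) \<le> C * (nonlocal_norm \<gamma>1 \<Omega> \<delta> v)\<^sup>2))"

definition Linf_esssup :: "'a::euclidean_space set \<Rightarrow> ('a \<Rightarrow> complex) \<Rightarrow> ereal" where
  "Linf_esssup E a = esssup (restrict_space lborel E) (\<lambda>p. ereal (cmod (a p)))"

definition Linf_space :: "'a::euclidean_space set \<Rightarrow> ('a \<Rightarrow> complex) set" where
  "Linf_space E = {a. set_borel_measurable lborel E a \<and> Linf_esssup E a < \<infinity>}"

definition Linf_norm :: "'a::euclidean_space set \<Rightarrow> ('a \<Rightarrow> complex) \<Rightarrow> real" where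
  "Linf_norm E a = real_of_ereal (Linf_esssup E a)"

text \<open>Complex Fr\'echet differentiability, at every point of \<open>U\<close>, of a map from
  $\mathbb{C}^N$ into the function space \<open>V\<close> with norm \<open>nrm\<close>. The derivative is
  \<open>h \<mapsto> (\<Sum>i. h\<^sub>i D\<^sub>i)\<close> with all \<open>D\<^sub>i\<close> in \<open>V\<close>, the general form
  of a (necessarily bounded) complex linear map from $\mathbb{C}^N$ to \<open>V\<close>.\<close>

definition holomorphic_map_on ::
  "('x \<Rightarrow> complex) set \<Rightarrow> (('x \<Rightarrow> complex) \<Rightarrow> real) \<Rightarrow> (complex ^ 'n \<Rightarrow> 'x \<Rightarrow> complex) \<Rightarrow>
   (complex ^ 'n::finite) set \<Rightarrow> bool" where
  "holomorphic_map_on V nrm F U \<longleftrightarrow>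
     open U \<and> (\<forall>z\<in>U. F z \<in> V) \<and>
     (\<forall>z\<in>U. \<exists>D :: 'n \<Rightarrow> 'x \<Rightarrow> complex. (\<forall>i. D i \<in> V) \<and>
        ((\<lambda>h. nrm (\<lambda>x. F (z + h) x - F z x - (\<Sum>i\<in>UNIV. h $ i * D i x)) / norm h) \<longlongrightarrow> 0) (at 0))"

definition conjugate_linear_dual ::
  "('x \<Rightarrow> complex) set \<Rightarrow> (('x \<Rightarrow> complex) \<Rightarrow> real) \<Rightarrow> (('x \<Rightarrow> complex) \<Rightarrow> complex) set" where
  "conjugate_linear_dual V nrm =
     {f. (\<forall>u\<in>V. \<forall>v\<in>V. f (\<lambda>x. u x + v x) = f u + f v) \<and>
         (\<forall>c. \<forall>v\<in>V. f (\<lambda>x. c * v x) = cnj c * f v) \<and>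
         (\<exists>C. \<forall>v\<in>V. cmod (f v) \<le> C * nrm v)}"

definition nonlocal_form :: "(real \<Rightarrow> real) \<Rightarrow> 'a::euclidean_space set \<Rightarrow> real \<Rightarrow>
    ('a \<times> 'a \<Rightarrow> complex) \<Rightarrow> ('a \<Rightarrow> complex) \<Rightarrow> ('a \<Rightarrow> complex) \<Rightarrow> complex" where
  "nonlocal_form \<gamma>1 \<Omega> \<delta> a u v =
     (LINT p:extended_square \<Omega> \<delta>|lborel.
        (case p of (x, y) \<Rightarrow>
          a (x, y) * complex_of_real (scaled_kernel TYPE('a) \<gamma>1 \<delta> (norm (x - y))) *
          (u y - u x) * cnj (v y - v x)))"

definition weak_solution :: "(real \<Rightarrow> real) \<Rightarrow> 'a::euclidean_space set \<Rightarrow> real \<Rightarrow>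
    ('a \<times> 'a \<Rightarrow> complex) \<Rightarrow> (('a \<Rightarrow> complex) \<Rightarrow> complex) \<Rightarrow> ('a \<Rightarrow> complex) \<Rightarrow> bool" where
  "weak_solution \<gamma>1 \<Omega> \<delta> a f u \<longleftrightarrow>
     u \<in> nonlocal_space \<gamma>1 \<Omega> \<delta> \<and>
     (\<forall>v\<in>nonlocal_space \<gamma>1 \<Omega> \<delta>. nonlocal_form \<gamma>1 \<Omega> \<delta> a u v = f v)"

definition uniquely_solvable :: "(real \<Rightarrow> real) \<Rightarrow> 'a::euclidean_space set \<Rightarrow> real \<Rightarrow>
    ('a \<times> 'a \<Rightarrow> complex) \<Rightarrow> (('a \<Rightarrow> complex) \<Rightarrow> complex) \<Rightarrow> bool" where
  "uniquely_solvable \<gamma>1 \<Omega> \<delta> a f \<longleftrightarrow>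
     (\<exists>u. weak_solution \<gamma>1 \<Omega> \<delta> a f u) \<and>
     (\<forall>u w. weak_solution \<gamma>1 \<Omega> \<delta> a f u \<and> weak_solution \<gamma>1 \<Omega> \<delta> a f w \<longrightarrow>
        (AE x in lborel. x \<in> extended_domain \<Omega> \<delta> \<longrightarrow> u x = w x))"

definition real_parameters :: "(real ^ 'n::finite) set" where
  "real_parameters = {\<xi>. \<forall>i. \<xi> $ i \<in> {-1..1}}"

definition complex_parameters :: "(complex ^ 'n::finite) set" where
  "complex_parameters = {\<xi>. \<forall>i. cmod (\<xi> $ i) \<le> 1}"

end

theory Submission
  imports Defs "HOL-Library.Function_Algebras"
begin

text \<open>
  For a coefficient whose real part is bounded below, the sesquilinear form is bounded and coercive
  on the energy space, which is complete by the nonlocal Poincare inequality and Fatou's lemma, so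
  Lax--Milgram gives unique solvability. A coefficient close in $L^\infty$ to a coercive one is still
  coercive, hence coercivity with constant \<open>rc / 2\<close> persists on a union of balls around the points
  of the polydisc. If \<open>A (z + h) = A z + (\<Sum>i. h\<^sub>i D\<^sub>i) + o(|h|)\<close> in $L^\infty$, the derivative
  \<open>d\<^sub>i\<close> of the solution solves the problem with coefficient \<open>A z\<close> and right-hand side minus
  the form of \<open>D\<^sub>i\<close> at the solution \<open>u z\<close>; testing the equation satisfied by
  \<open>u (z + h) - u z - (\<Sum>i. h\<^sub>i d\<^sub>i)\<close> with that function itself bounds its norm by \<open>o(|h|)\<close>.
\<close>

section \<open>Coercive forms on a semi-Hilbert space\<close>

text \<open>Representatives are arbitrary off the extended domain, and the energy norm vanishes on
  functions that are zero almost everywhere on it, so the energy space is a set of functions with a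
  seminorm. The Hilbert space argument therefore runs on a carrier set, without definiteness and
  without a quotient: representers and solutions are determined only up to seminorm zero, and only
  the identities they satisfy are used. The bridge to analysis is the map \<open>incr\<close>, which
  multiplies u(y) - u(x) by the square root of the kernel and is a linear isometry into L2 over
  pairs; norm and form become weighted L2 products. Poincare enters twice: it turns fast convergence
  in energy into almost everywhere convergence of the functions, from which a limit can be built,
  and it turns seminorm zero into equality almost everywhere. Linearity of the form in the
  coefficient carries the expansion of \<open>A\<close> over to the forms. The loss from
  \<open>rc\<close> to \<open>rc / 2\<close> buys one coercivity constant on the whole
  neighbourhood; the radii of the balls may vary from point to point.\<close>

definition conjugate_linear_on ::
  "(complex \<Rightarrow> 'v::ab_group_add \<Rightarrow> 'v) \<Rightarrow> 'v set \<Rightarrow> ('v \<Rightarrow> complex) \<Rightarrow> bool" where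
  "conjugate_linear_on sm V f \<longleftrightarrow>
     (\<forall>x\<in>V. \<forall>y\<in>V. f (x + y) = f x + f y) \<and> (\<forall>c. \<forall>x\<in>V. f (sm c x) = cnj c * f x)"

definition sesquilinear_on ::
  "(complex \<Rightarrow> 'v::ab_group_add \<Rightarrow> 'v) \<Rightarrow> 'v set \<Rightarrow> ('v \<Rightarrow> 'v \<Rightarrow> complex) \<Rightarrow> bool" where
  "sesquilinear_on sm V b \<longleftrightarrow>
     (\<forall>v\<in>V. \<forall>x\<in>V. \<forall>y\<in>V. b (x + y) v = b x v + b y v) \<and>
     (\<forall>v\<in>V. \<forall>c. \<forall>x\<in>V. b (sm c x) v = c * b x v) \<and>
     (\<forall>u\<in>V. conjugate_linear_on sm V (b u))"

definition bounded_functional_on :: "'v set \<Rightarrow> ('v \<Rightarrow> real) \<Rightarrow> ('v \<Rightarrow> complex) \<Rightarrow> bool" where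
  "bounded_functional_on V nrm f \<longleftrightarrow> (\<exists>C. \<forall>v\<in>V. cmod (f v) \<le> C * nrm v)"

definition bounded_form_on :: "'v set \<Rightarrow> ('v \<Rightarrow> real) \<Rightarrow> real \<Rightarrow> ('v \<Rightarrow> 'v \<Rightarrow> complex) \<Rightarrow> bool" where
  "bounded_form_on V nrm K b \<longleftrightarrow> (\<forall>u\<in>V. \<forall>v\<in>V. cmod (b u v) \<le> K * nrm u * nrm v)"

definition coercive_on :: "'v set \<Rightarrow> ('v \<Rightarrow> real) \<Rightarrow> real \<Rightarrow> ('v \<Rightarrow> 'v \<Rightarrow> complex) \<Rightarrow> bool" where
  "coercive_on V nrm r b \<longleftrightarrow> (\<forall>v\<in>V. r * (nrm v)\<^sup>2 \<le> Re (b v v))"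

lemma bounded_functional_onE:
  assumes "bounded_functional_on V nrm f" "\<And>v. 0 \<le> nrm v"
  obtains C where "0 \<le> C" "\<And>v. v \<in> V \<Longrightarrow> cmod (f v) \<le> C * nrm v"
proof -
  obtain C where C: "cmod (f v) \<le> C * nrm v" if "v \<in> V" for v
    using assms(1) by (auto simp: bounded_functional_on_def)
  have "cmod (f v) \<le> \<bar>C\<bar> * nrm v" if "v \<in> V" for v
    using C[OF that] mult_right_mono[OF abs_ge_self assms(2)] order_trans by blast
  then show ?thesis by (rule that[rotated]) auto
qed

text \<open>A polynomial in t that vanishes at 0 and is nonnegative everywhere has derivative zero
  there. This is the first-order condition at a minimiser in \<open>riesz\<close>.\<close>

lemma linear_coefficient_zero:
  fixes N X :: real
  assumes nonneg: "\<And>t. 0 \<le> t\<^sup>2 * N\<^sup>2 + 2 * t * X"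
  shows "X = 0"
proof -
  \<comment> \<open>The minimiser would be - X / N^2; the added 1 keeps the quotient meaningful for
    N = 0 and still gives a negative value unless X = 0.\<close>
  define t where "t = - X / (N\<^sup>2 + 1)"
  have pos: "N\<^sup>2 + 1 > 0" "N\<^sup>2 + 2 > 0"
    using zero_le_power2[of N] by linarith+
  then have X: "X = - t * (N\<^sup>2 + 1)" by (simp add: t_def)
  have "t\<^sup>2 * N\<^sup>2 + 2 * t * X = - (t\<^sup>2 * (N\<^sup>2 + 2))"
    by (subst X) algebra
  then have "t\<^sup>2 * (N\<^sup>2 + 2) \<le> 0" using nonneg[of t] by linarith
  then have "t\<^sup>2 \<le> 0" using pos(2) by (meson mult_pos_pos not_le)
  then show "X = 0" using X by simp
qed

text \<open>The scaling is a parameter because the vectors will be functions scaled pointwise by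
  complex numbers, while addition is the pointwise one of the function type.\<close>

locale complex_subspace = vector_space sm
  for sm :: "complex \<Rightarrow> 'v::ab_group_add \<Rightarrow> 'v" (infixr \<open>*c\<close> 75) +
  fixes V :: "'v set"
  assumes subspace_V: "subspace V"
begin

lemma V_closed [simp, intro]:
  "0 \<in> V" "x \<in> V \<Longrightarrow> y \<in> V \<Longrightarrow> x + y \<in> V" "x \<in> V \<Longrightarrow> y \<in> V \<Longrightarrow> x - y \<in> V"
  "x \<in> V \<Longrightarrow> - x \<in> V" "x \<in> V \<Longrightarrow> c *c x \<in> V"
  using subspace_V by (auto simp: subspace_0 subspace_add subspace_diff subspace_neg subspace_scale)

lemma V_sum [simp, intro]: "(\<And>i. i \<in> I \<Longrightarrow> g i \<in> V) \<Longrightarrow> sum g I \<in> V"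
  using subspace_V by (rule subspace_sum)

lemma conjugate_linear_scale:
  "conjugate_linear_on sm V f \<Longrightarrow> x \<in> V \<Longrightarrow> f (c *c x) = cnj c * f x"
  by (simp add: conjugate_linear_on_def)

lemma conjugate_linear_add:
  "conjugate_linear_on sm V f \<Longrightarrow> x \<in> V \<Longrightarrow> y \<in> V \<Longrightarrow> f (x + y) = f x + f y"
  by (simp add: conjugate_linear_on_def)

lemma conjugate_linear_diff:
  "conjugate_linear_on sm V f \<Longrightarrow> x \<in> V \<Longrightarrow> y \<in> V \<Longrightarrow> f (x - y) = f x - f y"
  using conjugate_linear_add[of f x "- y"] conjugate_linear_scale[of f y "-1"] by simp

lemmas conjugate_linear_arith =
  conjugate_linear_scale conjugate_linear_add conjugate_linear_diff

lemma sesquilinear_left: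
  assumes "sesquilinear_on sm V b" "v \<in> V"
  shows "x \<in> V \<Longrightarrow> b (c *c x) v = c * b x v"
    "x \<in> V \<Longrightarrow> y \<in> V \<Longrightarrow> b (x + y) v = b x v + b y v"
    "x \<in> V \<Longrightarrow> y \<in> V \<Longrightarrow> b (x - y) v = b x v - b y v"
proof -
  show scl: "b (c *c x) v = c * b x v" if "x \<in> V" for x c
    using assms that by (simp add: sesquilinear_on_def)
  show add: "b (x + y) v = b x v + b y v" if "x \<in> V" "y \<in> V" for x y
    using assms that by (simp add: sesquilinear_on_def)
  show "b (x - y) v = b x v - b y v" if "x \<in> V" "y \<in> V"
    using add[of x "- y"] scl[of y "-1"] that by simp
qed

lemma sesquilinear_right:
  assumes "sesquilinear_on sm V b" "v \<in> V"
  shows "x \<in> V \<Longrightarrow> b v (c *c x) = cnj c * b v x"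
    "x \<in> V \<Longrightarrow> y \<in> V \<Longrightarrow> b v (x + y) = b v x + b v y"
    "x \<in> V \<Longrightarrow> y \<in> V \<Longrightarrow> b v (x - y) = b v x - b v y"
proof -
  have "conjugate_linear_on sm V (b v)" using assms by (simp add: sesquilinear_on_def)
  from conjugate_linear_arith[OF this]
  show "x \<in> V \<Longrightarrow> b v (c *c x) = cnj c * b v x"
    "x \<in> V \<Longrightarrow> y \<in> V \<Longrightarrow> b v (x + y) = b v x + b v y"
    "x \<in> V \<Longrightarrow> y \<in> V \<Longrightarrow> b v (x - y) = b v x - b v y" by auto
qed

lemmas sesquilinear_arith = sesquilinear_left sesquilinear_right

lemma sesquilinear_sum_left:
  assumes "sesquilinear_on sm V b" "\<And>i. i \<in> I \<Longrightarrow> d i \<in> V" "v \<in> V"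
  shows "b (\<Sum>i\<in>I. c i *c d i) v = (\<Sum>i\<in>I. c i * b (d i) v)"
  using assms(2)
proof (induction I rule: infinite_finite_induct)
  case (insert i I)
  then show ?case by (simp add: sesquilinear_left[OF assms(1,3)])
qed (use sesquilinear_left(1)[OF assms(1,3) V_closed(1), of 0] in simp_all)

end

text \<open>Nothing forces a vector of norm zero to be 0, as is right for functions that are
  identified only almost everywhere.\<close>

locale semi_inner_space = complex_subspace sm V
  for sm :: "complex \<Rightarrow> 'v::ab_group_add \<Rightarrow> 'v" (infixr \<open>*c\<close> 75) and V +
  fixes ip :: "'v \<Rightarrow> 'v \<Rightarrow> complex" and nrm :: "'v \<Rightarrow> real"
  assumes ip_sesquilinear: "sesquilinear_on sm V ip"
    and ip_commute: "u \<in> V \<Longrightarrow> v \<in> V \<Longrightarrow> ip v u = cnj (ip u v)"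
    and ip_self: "u \<in> V \<Longrightarrow> ip u u = complex_of_real ((nrm u)\<^sup>2)"
    and nrm_nonneg [simp]: "0 \<le> nrm u"
begin

lemmas ip_arith = sesquilinear_arith[OF ip_sesquilinear]

lemma nrm_square: "u \<in> V \<Longrightarrow> (nrm u)\<^sup>2 = Re (ip u u)"
  by (simp add: ip_self)

lemma nrm_add_square:
  assumes "x \<in> V" "y \<in> V"
  shows "(nrm (x + y))\<^sup>2 = (nrm x)\<^sup>2 + (nrm y)\<^sup>2 + 2 * Re (ip x y)"
  using assms ip_commute[OF assms] by (simp add: nrm_square ip_arith)

lemma nrm_diff_square:
  assumes "x \<in> V" "y \<in> V"
  shows "(nrm (x - y))\<^sup>2 = (nrm x)\<^sup>2 + (nrm y)\<^sup>2 - 2 * Re (ip x y)"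
  using assms ip_commute[OF assms] by (simp add: nrm_square ip_arith)

lemma nrm_scale:
  assumes "x \<in> V" shows "nrm (c *c x) = cmod c * nrm x"
proof (rule power2_eq_imp_eq)
  have "ip (c *c x) (c *c x) = (c * cnj c) * ip x x"
    using assms by (simp add: ip_arith)
  also have "\<dots> = complex_of_real ((cmod c * nrm x)\<^sup>2)"
    using assms by (simp add: ip_self complex_norm_square[symmetric] power_mult_distrib)
  finally show "(nrm (c *c x))\<^sup>2 = (cmod c * nrm x)\<^sup>2"
    using assms by (simp add: nrm_square)
qed auto

lemma nrm_diff_commute: "x \<in> V \<Longrightarrow> y \<in> V \<Longrightarrow> nrm (x - y) = nrm (y - x)"
  using nrm_scale[of "x - y" "-1"] by simp

lemma nrm_zero: "nrm 0 = 0"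
  using nrm_scale[of 0 0] by simp

lemma cauchy_schwarz:
  assumes "u \<in> V" "v \<in> V"
  shows "cmod (ip u v) \<le> nrm u * nrm v"
proof -
  define c where "c = ip u v"
  \<comment> \<open>This expands the square of the norm of u - t c v. The factor c in front of v
    aligns the phases, so that the mixed term is real and equals t |c|^2.\<close>
  have *: "2 * t * (cmod c)\<^sup>2 \<le> (nrm u)\<^sup>2 + t\<^sup>2 * (cmod c)\<^sup>2 * (nrm v)\<^sup>2" for t :: real
  proof -
    have "Re (ip u ((complex_of_real t * c) *c v)) = t * (cmod c)\<^sup>2"
      using assms by (simp add: ip_arith c_def[symmetric] cmod_def) (simp add: power2_eq_square algebra_simps)
    then have "(nrm (u - (complex_of_real t * c) *c v))\<^sup>2
        = (nrm u)\<^sup>2 + t\<^sup>2 * (cmod c)\<^sup>2 * (nrm v)\<^sup>2 - 2 * (t * (cmod c)\<^sup>2)"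
      using assms by (simp add: nrm_diff_square nrm_scale norm_mult power_mult_distrib)
    then show ?thesis using zero_le_power2[of "nrm (u - (complex_of_real t * c) *c v)"] by simp
  qed
  have "(cmod c)\<^sup>2 \<le> (nrm u * nrm v)\<^sup>2"
  proof (cases "nrm v = 0")
    case True
    have "c = 0"
    proof (rule ccontr)
      assume "c \<noteq> 0"
      \<comment> \<open>With norm of v zero the bound on 2 t |c|^2 does not grow with t; this t
        makes the left side exceed the right side by exactly 1.\<close>
      then show False
        using *[of "((nrm u)\<^sup>2 + 1) / (2 * (cmod c)\<^sup>2)"] True by simp
    qed
    then show ?thesis by simp
  next
    case False
    \<comment> \<open>The value t = 1 / |v|^2 is the one for which t c v is the projection of u onto
      the line through v.\<close>
    then have "2 * (1 / (nrm v)\<^sup>2) * (cmod c)\<^sup>2 \<le> (nrm u)\<^sup>2 + (cmod c)\<^sup>2 / (nrm v)\<^sup>2"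
      using *[of "1 / (nrm v)\<^sup>2"] by (simp add: power2_eq_square)
    then have "(cmod c)\<^sup>2 / (nrm v)\<^sup>2 \<le> (nrm u)\<^sup>2" by simp
    then show ?thesis using False by (simp add: field_simps power_mult_distrib)
  qed
  then show ?thesis unfolding c_def by (rule power2_le_imp_le) simp
qed

lemma nrm_triangle:
  assumes "x \<in> V" "y \<in> V" shows "nrm (x + y) \<le> nrm x + nrm y"
proof (rule power2_le_imp_le)
  have "Re (ip x y) \<le> nrm x * nrm y"
    using cauchy_schwarz[OF assms] complex_Re_le_cmod[of "ip x y"] by linarith
  then show "(nrm (x + y))\<^sup>2 \<le> (nrm x + nrm y)\<^sup>2"
    using assms by (simp add: nrm_add_square power2_sum)
qed simp

lemma ip_bounded: "bounded_form_on V nrm 1 ip"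
  by (simp add: bounded_form_on_def cauchy_schwarz)

lemma form_tendsto:
  assumes b: "sesquilinear_on sm V b" "bounded_form_on V nrm K b"
    and V: "\<And>n. u n \<in> V" "l \<in> V" "v \<in> V" and lim: "(\<lambda>n. nrm (u n - l)) \<longlonglongrightarrow> 0"
  shows "(\<lambda>n. b (u n) v) \<longlonglongrightarrow> b l v"
proof -
  have "(\<lambda>n. b (u n) v - b l v) \<longlonglongrightarrow> 0"
  proof (rule Lim_null_comparison)
    show "\<forall>\<^sub>F n in sequentially. norm (b (u n) v - b l v) \<le> K * nrm (u n - l) * nrm v"
      using b V by (auto simp: sesquilinear_left(3)[symmetric] bounded_form_on_def intro!: always_eventually)
    show "(\<lambda>n. K * nrm (u n - l) * nrm v) \<longlonglongrightarrow> 0"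
      using tendsto_mult_right[OF tendsto_mult_left[OF lim], of K "nrm v"] by simp
  qed
  then show ?thesis by (simp add: LIM_zero_iff)
qed

text \<open>Cancelling one factor \<open>nrm v\<close> in r |v|^2 \<le> |b(v,v)| \<le> G |v| gives
  the a priori estimate. It serves uniqueness (with G = 0) as well as both estimates in
  \<open>solution_differentiable\<close>; the cancellation needs the case of norm zero
  apart.\<close>

lemma coercive_bound:
  assumes "coercive_on V nrm r b" "0 < r" "v \<in> V" "cmod (b v v) \<le> G * nrm v" "0 \<le> G"
  shows "nrm v \<le> G / r"
proof (cases "nrm v = 0")
  case False
  have "r * (nrm v)\<^sup>2 \<le> G * nrm v"
    using assms complex_Re_le_cmod[of "b v v"] unfolding coercive_on_def by fastforce
  then have "r * nrm v \<le> G"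
    using False by (simp add: power2_eq_square mult.assoc[symmetric] less_le)
  then show ?thesis using assms(2) by (simp add: field_simps)
qed (use assms in simp)

end

text \<open>Completeness is required only for sequences with geometrically decaying increments, which is
  all that the minimising sequence of \<open>riesz\<close> and the iteration of \<open>lax_milgram\<close> need.\<close>

locale semi_hilbert_space = semi_inner_space sm V ip nrm
  for sm :: "complex \<Rightarrow> 'v::ab_group_add \<Rightarrow> 'v" (infixr \<open>*c\<close> 75) and V ip nrm +
  assumes complete: "(\<And>n. u n \<in> V) \<Longrightarrow> 0 < q \<Longrightarrow> q < 1 \<Longrightarrow>
      (\<And>n. nrm (u (Suc n) - u n) \<le> c * q ^ n) \<Longrightarrow> \<exists>l\<in>V. (\<lambda>n. nrm (u n - l)) \<longlonglongrightarrow> 0"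
begin

text \<open>Direct method of the calculus of variations. The parallelogram identity turns
  near-minimality of consecutive terms into smallness of their difference, and the first variation
  in the directions w and i w gives the real and imaginary parts of the equation.\<close>

lemma riesz:
  assumes f: "conjugate_linear_on sm V f" "bounded_functional_on V nrm f"
  shows "\<exists>u\<in>V. \<forall>v\<in>V. ip u v = f v"
proof -
  note f_arith = conjugate_linear_arith[OF f(1)]
  obtain C where C: "0 \<le> C" "\<And>v. v \<in> V \<Longrightarrow> cmod (f v) \<le> C * nrm v"
    by (rule bounded_functional_onE[OF f(2) nrm_nonneg]) blast
  \<comment> \<open>If u represents f, then J v = |v - u|^2 - |u|^2, so minimising J means
    approaching u.\<close>
  define J where "J v = (nrm v)\<^sup>2 - 2 * Re (f v)" for v
  define m where "m = Inf (J ` V)"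
  have "- C\<^sup>2 \<le> J v" if "v \<in> V" for v
  proof -
    have "Re (f v) \<le> C * nrm v"
      using C(2)[OF that] complex_Re_le_cmod[of "f v"] by linarith
    then show ?thesis
      using zero_le_power2[of "nrm v - C"] by (simp add: J_def power2_diff algebra_simps)
  qed
  then have bdd: "bdd_below (J ` V)" by (auto intro!: bdd_belowI)
  have m_le: "m \<le> J v" if "v \<in> V" for v
    unfolding m_def using bdd that by (intro cInf_lower) auto
  \<comment> \<open>The rate 1/4 is chosen because distances are square roots of gaps in J; they
    will decay like (1/2)^n, as \<open>complete\<close> requires.\<close>
  have "\<exists>v\<in>V. J v < m + (1/4)^n" for n :: nat
  proof (rule ccontr)
    assume "\<not> ?thesis"
    then have "m + (1/4)^n \<le> m"
      unfolding m_def[of] by (intro cInf_greatest) (auto simp: not_less m_def[symmetric])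
    then show False using zero_less_power[of "1/4::real" n] by linarith
  qed
  then obtain v where v: "\<And>n. v n \<in> V" "\<And>n::nat. J (v n) < m + (1/4)^n" by metis
  \<comment> \<open>In the parallelogram identity the linear part of J cancels, since f is additive
    and the midpoint is weighted by 4.\<close>
  have par: "(nrm (x - y))\<^sup>2 = 2 * J x + 2 * J y - 4 * J ((1/2) *c (x + y))"
    if "x \<in> V" "y \<in> V" for x y
  proof -
    have "(nrm ((1/2) *c (x + y)))\<^sup>2 = (1/4) * (nrm (x + y))\<^sup>2"
      using that by (simp add: nrm_scale norm_divide power2_eq_square)
    moreover have "Re (f ((1/2) *c (x + y))) = (Re (f x) + Re (f y)) / 2"
      using that by (simp add: f_arith)
    ultimately show ?thesis
      using that by (simp add: J_def nrm_diff_square nrm_add_square)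
  qed
  have "nrm (v (Suc n) - v n) \<le> 2 * (1/2) ^ n" for n
  proof (rule power2_le_imp_le)
    have "m \<le> J ((1/2) *c (v (Suc n) + v n))" by (rule m_le) (use v in auto)
    then have "(nrm (v (Suc n) - v n))\<^sup>2 \<le> 2 * (1/4) ^ Suc n + 2 * (1/4) ^ n"
      using par[OF v(1) v(1), of "Suc n" n] v(2)[of n] v(2)[of "Suc n"] by linarith
    also have "\<dots> \<le> 4 * (1/4) ^ n" by simp
    also have "\<dots> = (2 * (1/2) ^ n)\<^sup>2"
      by (simp add: power_mult_distrib power2_eq_square[of "(1/2) ^ n"] power_mult_distrib[symmetric])
    finally show "(nrm (v (Suc n) - v n))\<^sup>2 \<le> (2 * (1/2) ^ n)\<^sup>2" .
  qed simp
  from complete[OF v(1) _ _ this] obtain l where l: "l \<in> V" "(\<lambda>n. nrm (v n - l)) \<longlonglongrightarrow> 0"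
    by auto
  have re: "Re (ip l w - f w) = 0" if w: "w \<in> V" for w
  proof -
    define X where "X = Re (ip l w - f w)"
    \<comment> \<open>The perturbation starts from the near-minimiser \<open>v n\<close> rather than
      from l: J can drop below J (v n) by at most (1/4)^n, and only the inner product with w has to
      pass to the limit.\<close>
    have "0 \<le> t\<^sup>2 * (nrm w)\<^sup>2 + 2 * t * X" for t :: real
    proof (rule LIMSEQ_le)
      show "(\<lambda>n. - ((1/4)^n)) \<longlonglongrightarrow> (0::real)"
        using tendsto_minus[OF LIMSEQ_power_zero[of "1/4::real"]] by simp
      have "(\<lambda>n. ip (v n) w) \<longlonglongrightarrow> ip l w"
        using ip_sesquilinear ip_bounded v(1) l(1) w l(2) by (rule form_tendsto)
      then show "(\<lambda>n. t\<^sup>2 * (nrm w)\<^sup>2 + 2 * t * Re (ip (v n) w - f w))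
          \<longlonglongrightarrow> t\<^sup>2 * (nrm w)\<^sup>2 + 2 * t * X"
        unfolding X_def by (intro tendsto_intros)
      have "- ((1/4)^n) \<le> t\<^sup>2 * (nrm w)\<^sup>2 + 2 * t * Re (ip (v n) w - f w)" for n
      proof -
        have "J (v n + complex_of_real t *c w) = J (v n) + t\<^sup>2 * (nrm w)\<^sup>2 + 2 * t * Re (ip (v n) w - f w)"
          using v w by (simp add: J_def nrm_add_square nrm_scale ip_arith f_arith power_mult_distrib
              algebra_simps)
        then show ?thesis
          using v(2)[of n] m_le[of "v n + complex_of_real t *c w"] v(1) w by simp
      qed
      then show "\<exists>N. \<forall>n\<ge>N. - ((1/4)^n) \<le> t\<^sup>2 * (nrm w)\<^sup>2 + 2 * t * Re (ip (v n) w - f w)" by auto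
    qed
    from linear_coefficient_zero[OF this] show ?thesis by (simp only: X_def)
  qed
  have "ip l w = f w" if w: "w \<in> V" for w
    \<comment> \<open>Conjugate linearity in the second argument makes the real part at i w equal to
      the imaginary part at w.\<close>
    using re[OF w] re[of "\<i> *c w"] w l(1) by (simp add: complex_eq_iff ip_arith f_arith)
  then show ?thesis using l(1) by blast
qed

text \<open>Here y is the residual at some point and y' the residual after the step \<rho> y. The
  difference z = y - y' represents \<rho> b(y, .), so |y'|^2 = |y|^2 - 2 \<rho> Re b(y,y) + |z|^2,
  where coercivity controls the middle term and boundedness the last. Residuals enter through their
  inner products alone, since representers are not unique.\<close>

lemma residual_contraction:
  assumes b: "sesquilinear_on sm V b" "bounded_form_on V nrm K b" "coercive_on V nrm r b"
    and V: "y \<in> V" "y' \<in> V" and \<rho>: "0 \<le> \<rho>" "0 \<le> K"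
    and step: "\<And>v. v \<in> V \<Longrightarrow> ip y' v = ip y v - complex_of_real \<rho> * b y v"
  shows "(nrm y')\<^sup>2 \<le> (1 - 2 * \<rho> * r + \<rho>\<^sup>2 * K\<^sup>2) * (nrm y)\<^sup>2"
proof -
  define z where "z = y - y'"
  have z: "z \<in> V" using V by (simp add: z_def)
  have ip_z: "ip z v = complex_of_real \<rho> * b y v" if "v \<in> V" for v
    using V that step by (simp add: z_def ip_arith)
  have "(nrm z)\<^sup>2 = cmod (ip z z)"
    using z by (simp add: ip_self norm_power)
  also have "\<dots> = \<rho> * cmod (b y z)"
    using z \<rho> by (simp add: ip_z norm_mult)
  also have "\<dots> \<le> \<rho> * (K * nrm y * nrm z)"
    using b(2) z V \<rho> by (intro mult_left_mono) (auto simp: bounded_form_on_def)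
  finally have "nrm z * nrm z \<le> (\<rho> * K * nrm y) * nrm z"
    by (simp add: power2_eq_square mult_ac)
  then have "nrm z \<le> \<rho> * K * nrm y"
    using \<rho> by (cases "nrm z = 0") (auto simp: less_le)
  then have "(nrm z)\<^sup>2 \<le> \<rho>\<^sup>2 * K\<^sup>2 * (nrm y)\<^sup>2"
    using power_mono[OF _ nrm_nonneg, of z "\<rho> * K * nrm y" 2] by (simp add: power_mult_distrib)
  moreover have "Re (ip y z) = \<rho> * Re (b y y)"
    using ip_commute[OF z V(1)] V by (simp add: ip_z)
  moreover have "\<rho> * (r * (nrm y)\<^sup>2) \<le> \<rho> * Re (b y y)"
    using b(3) V \<rho> by (intro mult_left_mono) (auto simp: coercive_on_def)
  moreover have "(nrm y')\<^sup>2 = (nrm y)\<^sup>2 + (nrm z)\<^sup>2 - 2 * Re (ip y z)"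
    using nrm_diff_square[OF V(1) z] by (simp add: z_def)
  ultimately show ?thesis by (simp add: algebra_simps)
qed

text \<open>Richardson iteration: each step adds \<rho> times the Riesz representer of the residual
  f - b(u, .). Residuals shrink by the factor q, so the increments of the iterates are geometric and
  a limit exists, at which the residual is zero.\<close>

theorem lax_milgram:
  assumes b: "sesquilinear_on sm V b" "bounded_form_on V nrm K b" "coercive_on V nrm r b" "0 < r"
    and f: "conjugate_linear_on sm V f" "bounded_functional_on V nrm f"
  shows "\<exists>u\<in>V. \<forall>v\<in>V. b u v = f v"
proof -
  note b_arith = sesquilinear_arith[OF b(1)] and f_arith = conjugate_linear_arith[OF f(1)]
  \<comment> \<open>Enlarging the bound makes it positive whatever the sign of K, and M \<ge> 2 r
    gives r / M < 1, hence q > 0.\<close>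
  define M where "M = \<bar>K\<bar> + 2 * r"
  have M: "0 < M" "2 * r \<le> M" using b(4) by (auto simp: M_def)
  have bM: "bounded_form_on V nrm M b"
    using b(2) b(4) unfolding bounded_form_on_def M_def
    by (intro ballI order_trans[OF b(2)[unfolded bounded_form_on_def, rule_format]] mult_right_mono)
       auto
  \<comment> \<open>This step size minimises the contraction factor 1 - 2 \<rho> r + \<rho>^2 M^2;
    the minimum is 1 - r^2 / M^2, the square of q.\<close>
  define \<rho> where "\<rho> = r / M\<^sup>2"
  define q where "q = sqrt (1 - r\<^sup>2 / M\<^sup>2)"
  have \<rho>: "0 < \<rho>" using b(4) M by (simp add: \<rho>_def)
  have "0 < r\<^sup>2 / M\<^sup>2" "r\<^sup>2 / M\<^sup>2 < 1"
    using b(4) M power_strict_mono[of r M 2] by (auto simp: divide_less_eq)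
  then have q: "0 < q" "q < 1" "q\<^sup>2 = 1 - r\<^sup>2 / M\<^sup>2"
    by (auto simp: q_def real_sqrt_pow2)
  have q_eq: "1 - 2 * \<rho> * r + \<rho>\<^sup>2 * M\<^sup>2 = q\<^sup>2"
    using M unfolding q(3) \<rho>_def by (simp add: power2_eq_square field_simps)
  obtain C where C: "0 \<le> C" "\<And>v. v \<in> V \<Longrightarrow> cmod (f v) \<le> C * nrm v"
    by (rule bounded_functional_onE[OF f(2) nrm_nonneg]) blast
  have "\<exists>R\<in>V. \<forall>v\<in>V. ip R v = f v - b u v" if u: "u \<in> V" for u
  proof (rule riesz)
    show "conjugate_linear_on sm V (\<lambda>v. f v - b u v)"
      unfolding conjugate_linear_on_def using u by (simp add: b_arith f_arith algebra_simps)
    have "cmod (f v - b u v) \<le> (C + M * nrm u) * nrm v" if v: "v \<in> V" for v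
    proof -
      have "cmod (f v - b u v) \<le> cmod (f v) + cmod (b u v)" by (rule norm_triangle_ineq4)
      also have "\<dots> \<le> C * nrm v + M * nrm u * nrm v"
        using C(2)[OF v] bM u v by (intro add_mono) (auto simp: bounded_form_on_def)
      finally show ?thesis by (simp add: algebra_simps)
    qed
    then show "bounded_functional_on V nrm (\<lambda>v. f v - b u v)"
      by (auto simp: bounded_functional_on_def)
  qed
  then obtain R where R: "\<And>u. u \<in> V \<Longrightarrow> R u \<in> V" "\<And>u v. u \<in> V \<Longrightarrow> v \<in> V \<Longrightarrow> ip (R u) v = f v - b u v"
    by metis
  define u where "u n = ((\<lambda>u. u + complex_of_real \<rho> *c R u) ^^ n) 0" for n
  have u_Suc: "u (Suc n) = u n + complex_of_real \<rho> *c R (u n)" for n by (simp add: u_def)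
  have u: "u n \<in> V" for n
    by (induction n) (simp_all add: u_Suc R, simp add: u_def)
  have decay: "nrm (R (u n)) \<le> q ^ n * nrm (R (u 0))" for n
  proof (induction n)
    case (Suc n)
    have "(nrm (R (u (Suc n))))\<^sup>2 \<le> (1 - 2 * \<rho> * r + \<rho>\<^sup>2 * M\<^sup>2) * (nrm (R (u n)))\<^sup>2"
    proof (rule residual_contraction[OF b(1) bM b(3)])
      fix v assume v: "v \<in> V"
      have "b (u (Suc n)) v = b (u n) v + complex_of_real \<rho> * b (R (u n)) v"
        using v u R(1) by (simp add: u_Suc b_arith)
      then show "ip (R (u (Suc n))) v = ip (R (u n)) v - complex_of_real \<rho> * b (R (u n)) v"
        using v u by (simp add: R)
    qed (use u R \<rho> M in auto)
    then have "(nrm (R (u (Suc n))))\<^sup>2 \<le> (q * nrm (R (u n)))\<^sup>2"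
      by (simp add: q_eq power_mult_distrib)
    then have "nrm (R (u (Suc n))) \<le> q * nrm (R (u n))"
      by (rule power2_le_imp_le) (use q in simp)
    also have "\<dots> \<le> q * (q ^ n * nrm (R (u 0)))"
      using Suc.IH q by (intro mult_left_mono) auto
    finally show ?case by simp
  qed simp
  have "nrm (u (Suc n) - u n) \<le> (\<rho> * nrm (R (u 0))) * q ^ n" for n
  proof -
    have "nrm (u (Suc n) - u n) = \<rho> * nrm (R (u n))"
      using u R \<rho> by (simp add: u_Suc nrm_scale)
    then show ?thesis using decay[of n] \<rho> by (simp add: mult_ac)
  qed
  from complete[OF u q(1,2) this] obtain l where l: "l \<in> V" "(\<lambda>n. nrm (u n - l)) \<longlonglongrightarrow> 0"
    by blast
  have "b l v = f v" if v: "v \<in> V" for v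
  proof (rule LIMSEQ_unique)
    show "(\<lambda>n. b (u n) v) \<longlonglongrightarrow> b l v"
      using b(1,2) u l(1) v l(2) by (rule form_tendsto)
    have "(\<lambda>n. b (u n) v - f v) \<longlonglongrightarrow> 0"
    proof (rule Lim_null_comparison)
      have "norm (b (u n) v - f v) \<le> q ^ n * nrm (R (u 0)) * nrm v" for n
      proof -
        have "norm (b (u n) v - f v) = cmod (ip (R (u n)) v)"
          using u v by (simp add: R norm_minus_commute)
        also have "\<dots> \<le> nrm (R (u n)) * nrm v"
          using u v R by (intro cauchy_schwarz) auto
        also have "\<dots> \<le> q ^ n * nrm (R (u 0)) * nrm v"
          using decay[of n] by (intro mult_right_mono) auto
        finally show ?thesis .
      qed
      then show "\<forall>\<^sub>F n in sequentially. norm (b (u n) v - f v) \<le> q ^ n * nrm (R (u 0)) * nrm v"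
        by simp
      have "(\<lambda>n. q ^ n) \<longlonglongrightarrow> 0" using q by (intro LIMSEQ_power_zero) simp
      then show "(\<lambda>n. q ^ n * nrm (R (u 0)) * nrm v) \<longlonglongrightarrow> 0"
        by (intro tendsto_mult_left_zero)
    qed
    then show "(\<lambda>n. b (u n) v) \<longlonglongrightarrow> f v" by (simp add: LIM_zero_iff)
  qed
  then show ?thesis using l(1) by blast
qed

text \<open>A two-stage estimate. The difference w = y h - x is of order \<sigma> h, where \<sigma>
  h bounds b h - b0. For e = w - (sum of h_i d_i) the choice of d removes the first-order term and
  leaves b0(e, .) equal to minus the remainder at x minus (b h - b0)(w, .). These have sizes \<rho>
  h and (\<sigma> h)^2, both o(|h|).\<close>

theorem solution_differentiable:
  fixes b :: "complex ^ 'n \<Rightarrow> 'v \<Rightarrow> 'v \<Rightarrow> complex" and \<beta> :: "'n::finite \<Rightarrow> 'v \<Rightarrow> 'v \<Rightarrow> complex"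
  assumes b0: "sesquilinear_on sm V b0" "bounded_form_on V nrm K b0" "coercive_on V nrm r b0" "0 < r"
    and \<beta>: "\<And>i. sesquilinear_on sm V (\<beta> i)" "\<And>i. bounded_form_on V nrm (M i) (\<beta> i)" "\<And>i. 0 \<le> M i"
    and b: "\<forall>\<^sub>F h in at 0. sesquilinear_on sm V (b h) \<and> coercive_on V nrm r (b h)"
    and rem: "\<forall>\<^sub>F h in at 0. bounded_form_on V nrm (\<rho> h) (\<lambda>u v. b h u v - b0 u v - (\<Sum>i\<in>UNIV. h $ i * \<beta> i u v))"
    and \<rho>: "\<And>h. 0 \<le> \<rho> h" "((\<lambda>h. \<rho> h / norm h) \<longlongrightarrow> 0) (at 0)"
    and x: "x \<in> V" "\<And>v. v \<in> V \<Longrightarrow> b0 x v = f v"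
    and y: "\<forall>\<^sub>F h in at 0. y h \<in> V \<and> (\<forall>v\<in>V. b h (y h) v = f v)"
  shows "\<exists>d. (\<forall>i. d i \<in> V) \<and>
    ((\<lambda>h. nrm (y h - x - (\<Sum>i\<in>UNIV. (h $ i) *c d i)) / norm h) \<longlongrightarrow> 0) (at 0)"
proof -
  have "\<exists>d\<in>V. \<forall>v\<in>V. b0 d v = - \<beta> i x v" for i
  proof (rule lax_milgram[OF b0])
    show "conjugate_linear_on sm V (\<lambda>v. - \<beta> i x v)"
      unfolding conjugate_linear_on_def using x(1) by (simp add: sesquilinear_arith[OF \<beta>(1)])
    show "bounded_functional_on V nrm (\<lambda>v. - \<beta> i x v)"
      using \<beta>(2)[of i] x(1) by (auto simp: bounded_functional_on_def bounded_form_on_def)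
  qed
  then obtain d where d: "\<And>i. d i \<in> V" "\<And>i v. v \<in> V \<Longrightarrow> b0 (d i) v = - \<beta> i x v" by metis
  define \<sigma> where "\<sigma> h = \<rho> h + norm h * (\<Sum>i\<in>UNIV. M i)" for h
  have \<sigma>: "0 \<le> \<sigma> h" for h using \<rho>(1) \<beta>(3) by (simp add: \<sigma>_def sum_nonneg)
  let ?B = "\<lambda>h. (\<rho> h * nrm x + \<sigma> h * (\<sigma> h * nrm x / r)) / r"
  have bound: "\<forall>\<^sub>F h in at 0. nrm (y h - x - (\<Sum>i\<in>UNIV. (h $ i) *c d i)) \<le> ?B h"
    using b rem y
  proof eventually_elim
    case (elim h)
    note bh_arith = sesquilinear_arith[OF conjunct1[OF elim(1)]]
    have y: "y h \<in> V" "\<And>v. v \<in> V \<Longrightarrow> b h (y h) v = f v" using elim by auto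
    let ?L = "\<lambda>u v. \<Sum>i\<in>UNIV. h $ i * \<beta> i u v"
    let ?D = "\<Sum>i\<in>UNIV. (h $ i) *c d i"
    have remb: "cmod (b h u v - b0 u v - ?L u v) \<le> \<rho> h * nrm u * nrm v" if "u \<in> V" "v \<in> V" for u v
      using elim(2) that by (auto simp: bounded_form_on_def)
    have diff: "cmod (b h u v - b0 u v) \<le> \<sigma> h * nrm u * nrm v" if uv: "u \<in> V" "v \<in> V" for u v
    proof -
      have "cmod (?L u v) \<le> (\<Sum>i\<in>UNIV. norm h * (M i * nrm u * nrm v))"
      proof (rule sum_norm_le)
        fix i
        have "cmod (\<beta> i u v) \<le> M i * nrm u * nrm v"
          using \<beta>(2) uv by (auto simp: bounded_form_on_def)
        then show "cmod (h $ i * \<beta> i u v) \<le> norm h * (M i * nrm u * nrm v)"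
          unfolding norm_mult by (intro mult_mono) (auto simp: Finite_Cartesian_Product.norm_nth_le)
      qed
      also have "\<dots> = norm h * (\<Sum>i\<in>UNIV. M i) * nrm u * nrm v"
        by (simp add: sum_distrib_left sum_distrib_right mult_ac)
      finally have "cmod (?L u v) \<le> norm h * (\<Sum>i\<in>UNIV. M i) * nrm u * nrm v" .
      moreover have "cmod (b h u v - b0 u v) \<le> cmod (b h u v - b0 u v - ?L u v) + cmod (?L u v)"
        using norm_triangle_sub[of "b h u v - b0 u v" "?L u v"] by (simp add: add.commute)
      ultimately show ?thesis using remb[OF uv] by (simp add: \<sigma>_def algebra_simps)
    qed
    define w where "w = y h - x"
    have w: "w \<in> V" using y x by (simp add: w_def)
    \<comment> \<open>Both y h and x solve with the same f, so f drops out and only the change of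
      the form at x is left.\<close>
    have bw: "b h w v = - (b h x v - b0 x v)" if "v \<in> V" for v
      using that x y by (simp add: w_def bh_arith)
    have w_bound: "nrm w \<le> \<sigma> h * nrm x / r"
    proof (rule coercive_bound[OF conjunct2[OF elim(1)] b0(4) w])
      show "cmod (b h w w) \<le> \<sigma> h * nrm x * nrm w"
        unfolding bw[OF w] norm_minus_cancel using x(1) w by (rule diff)
    qed (use \<sigma> in auto)
    define e where "e = w - ?D"
    have D: "?D \<in> V" using d by auto
    have e: "e \<in> V" using w D by (simp add: e_def)
    have "b0 ?D e = - ?L x e"
      using sesquilinear_sum_left[OF b0(1) _ e, of UNIV d "\<lambda>i. h $ i"] d e by (simp add: sum_negf)
    then have "b0 e e = b0 w e + ?L x e"
      using sesquilinear_left(3)[OF b0(1) e w D] by (simp add: e_def)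
    \<comment> \<open>Adding and subtracting b h w e, whose value is known from \<open>bw\<close>,
      groups everything into the expansion remainder at x and a product of two small
      factors.\<close>
    also have "\<dots> = - (b h x e - b0 x e - ?L x e) - (b h w e - b0 w e)"
      using bw[OF e] by simp
    finally have "cmod (b0 e e) \<le> cmod (b h x e - b0 x e - ?L x e) + cmod (b h w e - b0 w e)"
      using norm_triangle_ineq4[of "- (b h x e - b0 x e - ?L x e)" "b h w e - b0 w e"]
      by (simp only: norm_minus_cancel)
    also have "\<dots> \<le> \<rho> h * nrm x * nrm e + \<sigma> h * nrm w * nrm e"
      using remb[OF x(1) e] diff[OF w e] by linarith
    also have "\<dots> \<le> \<rho> h * nrm x * nrm e + \<sigma> h * (\<sigma> h * nrm x / r) * nrm e"
      using w_bound \<sigma> by (intro add_left_mono mult_right_mono mult_left_mono) auto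
    finally have "cmod (b0 e e) \<le> (\<rho> h * nrm x + \<sigma> h * (\<sigma> h * nrm x / r)) * nrm e"
      by (simp add: algebra_simps)
    then have "nrm e \<le> ?B h"
      by (rule coercive_bound[OF b0(3,4) e]) (use \<sigma> \<rho>(1) b0(4) in simp)
    then show ?case by (simp add: e_def w_def)
  qed
  have lim: "((\<lambda>h. ?B h / norm h) \<longlongrightarrow> 0) (at 0)"
  proof -
    let ?S = "\<Sum>i\<in>UNIV. M i"
    \<comment> \<open>Writing \<sigma> h as (\<rho> h / |h| + S) |h| displays (\<sigma> h)^2 / |h|
      as a bounded factor times |h|; the two expressions agree for h \<noteq> 0.\<close>
    let ?G = "\<lambda>h. (\<rho> h / norm h * nrm x + (\<rho> h / norm h + ?S) * (\<rho> h / norm h + ?S) * norm h * nrm x / r) / r"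
    have "(?G \<longlongrightarrow> (0 * nrm x + (0 + ?S) * (0 + ?S) * norm (0::complex ^ 'n) * nrm x / r) / r) (at 0)"
      using b0(4) by (intro tendsto_intros \<rho>(2)) auto
    moreover have "\<forall>\<^sub>F h in at 0. ?G h = ?B h / norm h"
      unfolding eventually_at_filter
    proof (intro always_eventually allI impI)
      fix h :: "complex ^ 'n" assume "h \<noteq> 0"
      then have \<sigma>_eq: "\<sigma> h = (\<rho> h / norm h + ?S) * norm h" by (simp add: \<sigma>_def field_simps)
      have "(a / n * X + R * R * n * X / r) / r = (a * X + R * n * (R * n * X / r)) / r / n"
        if "n \<noteq> 0" for a n X R :: real
        using that b0(4) by (simp add: field_simps)
      then show "?G h = ?B h / norm h"
        unfolding \<sigma>_eq using \<open>h \<noteq> 0\<close> by simp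
    qed
    ultimately show ?thesis by (simp add: tendsto_cong)
  qed
  have "((\<lambda>h. nrm (y h - x - (\<Sum>i\<in>UNIV. (h $ i) *c d i)) / norm h) \<longlongrightarrow> 0) (at 0)"
  proof (rule Lim_null_comparison[OF _ lim])
    show "\<forall>\<^sub>F h in at 0. norm (nrm (y h - x - (\<Sum>i\<in>UNIV. (h $ i) *c d i)) / norm h) \<le> ?B h / norm h"
      using bound by eventually_elim (simp add: divide_right_mono del: divide_divide_eq_left)
  qed
  then show ?thesis using d(1) by blast
qed

end

section \<open>Square-integrable functions\<close>

lemma L2_cauchy_schwarz:
  fixes f g :: "'x \<Rightarrow> real"
  assumes [measurable]: "f \<in> borel_measurable M" "g \<in> borel_measurable M"
    and f: "integrable M (\<lambda>x. (f x)\<^sup>2)" "\<And>x. 0 \<le> f x" and g: "integrable M (\<lambda>x. (g x)\<^sup>2)" "\<And>x. 0 \<le> g x"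
  shows "integrable M (\<lambda>x. f x * g x)"
    "(\<integral>x. f x * g x \<partial>M) \<le> sqrt (\<integral>x. (f x)\<^sup>2 \<partial>M) * sqrt (\<integral>x. (g x)\<^sup>2 \<partial>M)"
proof -
  show fg: "integrable M (\<lambda>x. f x * g x)"
  proof (rule Bochner_Integration.integrable_bound)
    show "integrable M (\<lambda>x. (f x)\<^sup>2 + (g x)\<^sup>2)" using f g by simp
    have "f x * g x \<le> (f x)\<^sup>2 + (g x)\<^sup>2" for x
      using sum_squares_bound[of "f x" "g x"] f(2)[of x] g(2)[of x] mult_nonneg_nonneg[of "f x" "g x"]
      by linarith
    then show "AE x in M. norm (f x * g x) \<le> norm ((f x)\<^sup>2 + (g x)\<^sup>2)"
      using f(2) g(2) by (intro AE_I2) simp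
  qed simp
  have "(\<integral>\<^sup>+x. ennreal (f x) * ennreal (g x) \<partial>M)\<^sup>2
      \<le> (\<integral>\<^sup>+x. (ennreal (f x))\<^sup>2 \<partial>M) * (\<integral>\<^sup>+x. (ennreal (g x))\<^sup>2 \<partial>M)"
    by (rule Cauchy_Schwarz_nn_integral) auto
  also have "(\<integral>\<^sup>+x. ennreal (f x) * ennreal (g x) \<partial>M) = ennreal (\<integral>x. f x * g x \<partial>M)"
    using fg f(2) g(2) by (subst nn_integral_eq_integral[symmetric]) (auto simp: ennreal_mult)
  also have "(\<integral>\<^sup>+x. (ennreal (f x))\<^sup>2 \<partial>M) = ennreal (\<integral>x. (f x)\<^sup>2 \<partial>M)"
    using f by (subst nn_integral_eq_integral[symmetric]) (auto simp: ennreal_power)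
  also have "(\<integral>\<^sup>+x. (ennreal (g x))\<^sup>2 \<partial>M) = ennreal (\<integral>x. (g x)\<^sup>2 \<partial>M)"
    using g by (subst nn_integral_eq_integral[symmetric]) (auto simp: ennreal_power)
  finally have "(\<integral>x. f x * g x \<partial>M)\<^sup>2 \<le> (\<integral>x. (f x)\<^sup>2 \<partial>M) * (\<integral>x. (g x)\<^sup>2 \<partial>M)"
    using f(2) g(2) by (simp add: ennreal_power ennreal_mult[symmetric])
  then show "(\<integral>x. f x * g x \<partial>M) \<le> sqrt (\<integral>x. (f x)\<^sup>2 \<partial>M) * sqrt (\<integral>x. (g x)\<^sup>2 \<partial>M)"
    by (simp add: real_sqrt_mult[symmetric] real_le_rsqrt)
qed

lemma borel_measurable_cnj [measurable]:
  "g \<in> borel_measurable M \<Longrightarrow> (\<lambda>x. cnj (g x)) \<in> borel_measurable M"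
  by (rule measurable_compose[OF _ borel_measurable_continuous_onI[where f=cnj]]) (auto intro: continuous_intros)

text \<open>The weight will be the coefficient and the two factors \<open>incr u\<close> and
  \<open>incr v\<close>: this is where integrability and boundedness of all nonlocal forms come
  from.\<close>

lemma L2_weighted_product:
  fixes a f g :: "'x \<Rightarrow> complex"
  assumes [measurable]: "a \<in> borel_measurable M" "f \<in> borel_measurable M" "g \<in> borel_measurable M"
    and f: "integrable M (\<lambda>x. (cmod (f x))\<^sup>2)" and g: "integrable M (\<lambda>x. (cmod (g x))\<^sup>2)"
    and a: "AE x in M. cmod (a x) \<le> K" and K: "0 \<le> K"
  shows "integrable M (\<lambda>x. a x * f x * cnj (g x))"
    "cmod (\<integral>x. a x * f x * cnj (g x) \<partial>M)
      \<le> K * sqrt (\<integral>x. (cmod (f x))\<^sup>2 \<partial>M) * sqrt (\<integral>x. (cmod (g x))\<^sup>2 \<partial>M)"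
proof -
  have fg: "integrable M (\<lambda>x. cmod (f x) * cmod (g x))"
    "(\<integral>x. cmod (f x) * cmod (g x) \<partial>M) \<le> sqrt (\<integral>x. (cmod (f x))\<^sup>2 \<partial>M) * sqrt (\<integral>x. (cmod (g x))\<^sup>2 \<partial>M)"
    using f g by (auto intro!: L2_cauchy_schwarz)
  have bound: "AE x in M. cmod (a x * f x * cnj (g x)) \<le> K * (cmod (f x) * cmod (g x))"
    using a
  proof eventually_elim
    fix x assume "cmod (a x) \<le> K"
    then have "cmod (a x) * (cmod (f x) * cmod (g x)) \<le> K * (cmod (f x) * cmod (g x))"
      by (intro mult_right_mono) auto
    then show "cmod (a x * f x * cnj (g x)) \<le> K * (cmod (f x) * cmod (g x))"
      by (simp add: norm_mult mult.assoc)
  qed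
  show int: "integrable M (\<lambda>x. a x * f x * cnj (g x))"
  proof (rule Bochner_Integration.integrable_bound)
    show "integrable M (\<lambda>x. K * (cmod (f x) * cmod (g x)))" using fg(1) by simp
    show "(\<lambda>x. a x * f x * cnj (g x)) \<in> borel_measurable M" by measurable
    show "AE x in M. norm (a x * f x * cnj (g x)) \<le> norm (K * (cmod (f x) * cmod (g x)))"
      using bound by eventually_elim (use K in \<open>simp add: abs_mult\<close>)
  qed
  have "cmod (\<integral>x. a x * f x * cnj (g x) \<partial>M) \<le> (\<integral>x. cmod (a x * f x * cnj (g x)) \<partial>M)"
    by (rule integral_norm_bound)
  also have "\<dots> \<le> (\<integral>x. K * (cmod (f x) * cmod (g x)) \<partial>M)"
    by (rule integral_mono_AE[OF _ _ bound]) (use int fg(1) in auto)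
  also have "\<dots> \<le> K * (sqrt (\<integral>x. (cmod (f x))\<^sup>2 \<partial>M) * sqrt (\<integral>x. (cmod (g x))\<^sup>2 \<partial>M))"
    unfolding integral_mult_right_zero by (rule mult_left_mono[OF fg(2) K])
  finally show "cmod (\<integral>x. a x * f x * cnj (g x) \<partial>M)
      \<le> K * sqrt (\<integral>x. (cmod (f x))\<^sup>2 \<partial>M) * sqrt (\<integral>x. (cmod (g x))\<^sup>2 \<partial>M)" by (simp add: mult.assoc)
qed

lemma integrable_norm_square_add:
  fixes f g :: "'x \<Rightarrow> 'b::{real_normed_vector, second_countable_topology}"
  assumes [measurable]: "f \<in> borel_measurable M" "g \<in> borel_measurable M"
    and f: "integrable M (\<lambda>x. (norm (f x))\<^sup>2)" and g: "integrable M (\<lambda>x. (norm (g x))\<^sup>2)"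
  shows "integrable M (\<lambda>x. (norm (f x + g x))\<^sup>2)"
proof (rule Bochner_Integration.integrable_bound)
  show "integrable M (\<lambda>x. 2 * (norm (f x))\<^sup>2 + 2 * (norm (g x))\<^sup>2)" using f g by simp
  have "(norm (f x + g x))\<^sup>2 \<le> 2 * (norm (f x))\<^sup>2 + 2 * (norm (g x))\<^sup>2" for x
  proof -
    have "(norm (f x + g x))\<^sup>2 \<le> (norm (f x) + norm (g x))\<^sup>2"
      by (intro power_mono norm_triangle_ineq) auto
    also have "\<dots> \<le> 2 * (norm (f x))\<^sup>2 + 2 * (norm (g x))\<^sup>2"
      using sum_squares_bound[of "norm (f x)" "norm (g x)"] by (simp add: power2_sum)
    finally show ?thesis .
  qed
  then show "AE x in M. norm ((norm (f x + g x))\<^sup>2) \<le> norm (2 * (norm (f x))\<^sup>2 + 2 * (norm (g x))\<^sup>2)"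
    by (intro AE_I2) simp
qed measurable

text \<open>The bound is asked for only eventually, because in a sequence with geometric increments
  the distance to the n-th term is controlled for later indices.\<close>

lemma L2_fatou:
  fixes f :: "'x \<Rightarrow> 'b::{real_normed_vector, second_countable_topology}"
  assumes [measurable]: "\<And>n. F n \<in> borel_measurable M" "f \<in> borel_measurable M"
    and F: "\<And>n. integrable M (\<lambda>x. (norm (F n x))\<^sup>2)"
    and B: "\<forall>\<^sub>F n in sequentially. (\<integral>x. (norm (F n x))\<^sup>2 \<partial>M) \<le> B"
    and lim: "AE x in M. (\<lambda>n. F n x) \<longlonglongrightarrow> f x"
  shows "integrable M (\<lambda>x. (norm (f x))\<^sup>2)" "(\<integral>x. (norm (f x))\<^sup>2 \<partial>M) \<le> B"
proof -
  obtain n where "(\<integral>x. (norm (F n x))\<^sup>2 \<partial>M) \<le> B"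
    using B by (auto simp: eventually_sequentially)
  moreover have "0 \<le> (\<integral>x. (norm (F n x))\<^sup>2 \<partial>M)" by simp
  ultimately have B0: "0 \<le> B" by linarith
  have "(\<integral>\<^sup>+x. ennreal ((norm (f x))\<^sup>2) \<partial>M) = (\<integral>\<^sup>+x. liminf (\<lambda>n. ennreal ((norm (F n x))\<^sup>2)) \<partial>M)"
  proof (rule nn_integral_cong_AE, use lim in eventually_elim)
    fix x assume "(\<lambda>n. F n x) \<longlonglongrightarrow> f x"
    then have "(\<lambda>n. ennreal ((norm (F n x))\<^sup>2)) \<longlonglongrightarrow> ennreal ((norm (f x))\<^sup>2)"
      by (intro tendsto_ennrealI tendsto_intros)
    then show "ennreal ((norm (f x))\<^sup>2) = liminf (\<lambda>n. ennreal ((norm (F n x))\<^sup>2))"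
      by (rule lim_imp_Liminf[OF sequentially_bot, symmetric])
  qed
  also have "\<dots> \<le> liminf (\<lambda>n. \<integral>\<^sup>+x. ennreal ((norm (F n x))\<^sup>2) \<partial>M)"
    by (rule nn_integral_liminf) measurable
  also have "\<dots> \<le> ennreal B"
  proof -
    have "\<forall>\<^sub>F n in sequentially. (\<integral>\<^sup>+x. ennreal ((norm (F n x))\<^sup>2) \<partial>M) \<le> ennreal B"
      using B by eventually_elim (use F in \<open>simp add: nn_integral_eq_integral ennreal_leI\<close>)
    then show ?thesis
      by (intro order_trans[OF Liminf_le_Limsup] Limsup_bounded) auto
  qed
  finally have le: "(\<integral>\<^sup>+x. ennreal ((norm (f x))\<^sup>2) \<partial>M) \<le> ennreal B" .
  show int: "integrable M (\<lambda>x. (norm (f x))\<^sup>2)"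
    using le_less_trans[OF le ennreal_less_top] by (intro integrableI_nonneg) auto
  show "(\<integral>x. (norm (f x))\<^sup>2 \<partial>M) \<le> B"
    using le int B0 by (simp add: nn_integral_eq_integral)
qed

text \<open>The weighted series of \<open>q\<^sup>-\<^sup>n \<cdot> |w\<^sub>n|\<^sup>2\<close> still has finite integral, so almost everywhere
  \<open>|w\<^sub>n|\<close> is dominated by a multiple of \<open>\<surd>q\<^sup>n\<close>.\<close>

lemma AE_summable_of_geometric_L2:
  fixes w :: "nat \<Rightarrow> 'x \<Rightarrow> 'b::{banach, second_countable_topology}"
  assumes [measurable]: "\<And>n. w n \<in> borel_measurable M"
    and w: "\<And>n. integrable M (\<lambda>x. (norm (w n x))\<^sup>2)"
    and B: "\<And>n. (\<integral>x. (norm (w n x))\<^sup>2 \<partial>M) \<le> B * (q ^ n)\<^sup>2" and q: "0 < q" "q < 1"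
  shows "AE x in M. summable (\<lambda>n. w n x)"
proof -
  let ?g = "\<lambda>n x. (norm (w n x))\<^sup>2 / q ^ n"
  have B0: "0 \<le> B"
  proof -
    have "0 \<le> (\<integral>x. (norm (w 0 x))\<^sup>2 \<partial>M)" by simp
    from order_trans[OF this B[of 0]] show ?thesis by simp
  qed
  have "(\<integral>\<^sup>+x. (\<Sum>n. ennreal (?g n x)) \<partial>M) = (\<Sum>n. \<integral>\<^sup>+x. ennreal (?g n x) \<partial>M)"
    by (rule nn_integral_suminf) measurable
  also have "\<dots> \<le> (\<Sum>n. ennreal (B * q ^ n))"
  proof (rule suminf_le)
    fix n
    have "(\<integral>\<^sup>+x. ennreal (?g n x) \<partial>M) = ennreal ((\<integral>x. (norm (w n x))\<^sup>2 \<partial>M) / q ^ n)"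
      using w[of n] q by (subst nn_integral_eq_integral) auto
    also have "(\<integral>x. (norm (w n x))\<^sup>2 \<partial>M) / q ^ n \<le> B * q ^ n"
      using B[of n] q by (simp add: field_simps power2_eq_square)
    finally show "(\<integral>\<^sup>+x. ennreal (?g n x) \<partial>M) \<le> ennreal (B * q ^ n)" by (simp add: ennreal_leI)
  qed auto
  also have "\<dots> = ennreal (\<Sum>n. B * q ^ n)"
    using B0 q by (intro suminf_ennreal2) (auto intro: summable_mult summable_geometric)
  finally have "(\<integral>\<^sup>+x. (\<Sum>n. ennreal (?g n x)) \<partial>M) \<noteq> \<infinity>"
    by (auto simp: top_unique)
  then have "AE x in M. (\<Sum>n. ennreal (?g n x)) \<noteq> \<infinity>"
    by (intro nn_integral_PInf_AE) measurable
  then show ?thesis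
  proof eventually_elim
    fix x assume "(\<Sum>n. ennreal (?g n x)) \<noteq> \<infinity>"
    then have "summable (\<lambda>n. ?g n x)"
      using q by (intro summable_suminf_not_top) auto
    then have "Bseq (\<lambda>n. ?g n x)"
      using summable_LIMSEQ_zero convergentI convergent_imp_Bseq by blast
    then obtain K where K: "0 < K" "\<And>n. ?g n x \<le> K"
      using q by (auto simp: Bseq_def)
    have "norm (w n x) \<le> sqrt K * sqrt q ^ n" for n
    proof (rule power2_le_imp_le)
      have "(norm (w n x))\<^sup>2 \<le> K * q ^ n" using K(2)[of n] q by (simp add: field_simps)
      also have "\<dots> = (sqrt K * sqrt q ^ n)\<^sup>2"
        using K(1) q by (simp add: power_mult_distrib power_mult[symmetric] mult.commute[of n 2] power_mult)
      finally show "(norm (w n x))\<^sup>2 \<le> (sqrt K * sqrt q ^ n)\<^sup>2" .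
    qed (use K(1) q in simp)
    moreover have "summable (\<lambda>n. sqrt K * sqrt q ^ n)"
      using q by (intro summable_mult summable_geometric) simp
    ultimately show "summable (\<lambda>n. w n x)" by (rule summable_comparison_test'[rotated])
  qed
qed

text \<open>If P fails only on a null set N, the pair property fails only on N \<times> UNIV
  \<union> UNIV \<times> N, a null set for the product measure. It lifts convergence of functions to
  convergence of their increments.\<close>

lemma AE_lborel_pair:
  assumes "AE x in (lborel :: 'a::euclidean_space measure). P x"
  shows "AE p in lborel. P (fst p) \<and> P (snd (p :: 'a \<times> 'a))"
proof -
  obtain N where N: "\<And>x. x \<in> space lborel - N \<Longrightarrow> P x" "N \<in> null_sets lborel"
    using AE_E3[OF assms] by metis
  have N': "N \<in> sets lborel" "emeasure lborel N = 0" using N(2) by auto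
  have "N \<times> (UNIV :: 'a set) \<in> null_sets (lborel \<Otimes>\<^sub>M lborel)"
    using lborel.emeasure_pair_measure_Times[of N lborel "UNIV :: 'a set"] N'
    by (intro null_setsI) auto
  moreover have "(UNIV :: 'a set) \<times> N \<in> null_sets (lborel \<Otimes>\<^sub>M lborel)"
    using lborel.emeasure_pair_measure_Times[of "UNIV :: 'a set" lborel N] N'
    by (intro null_setsI) auto
  ultimately have "N \<times> UNIV \<union> UNIV \<times> N \<in> null_sets (lborel \<Otimes>\<^sub>M (lborel :: 'a measure))"
    by (rule null_sets.Un)
  then have "N \<times> UNIV \<union> UNIV \<times> N \<in> null_sets (lborel :: ('a \<times> 'a) measure)"
    by (simp add: lborel_prod)
  moreover have "{p \<in> space lborel. \<not> (P (fst p) \<and> P (snd p))} \<subseteq> N \<times> UNIV \<union> UNIV \<times> N"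
  proof
    fix p assume "p \<in> {p \<in> space lborel. \<not> (P (fst p) \<and> P (snd p))}"
    then have "fst p \<in> N \<or> snd p \<in> N" using N(1)[of "fst p"] N(1)[of "snd p"] by auto
    then show "p \<in> N \<times> UNIV \<union> UNIV \<times> N" by (cases p) simp
  qed
  ultimately show ?thesis by (rule AE_I')
qed

lemma (in semi_inner_space) geometric_increments:
  assumes u: "\<And>n. u n \<in> V" and q: "0 < q" "q < 1"
    and step: "\<And>n. nrm (u (Suc n) - u n) \<le> c * q ^ n" and le: "n \<le> m"
  shows "nrm (u m - u n) \<le> c / (1 - q) * q ^ n"
proof -
  have c: "0 \<le> c" using order_trans[OF nrm_nonneg step[of 0]] by simp
  \<comment> \<open>Keeping the subtracted power, the exact value of the partial geometric sum, is
    what lets the induction close.\<close>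
  have "nrm (u (n + k) - u n) \<le> c / (1 - q) * (q ^ n - q ^ (n + k))" for k
  proof (induction k)
    case (Suc k)
    have "nrm (u (n + Suc k) - u n) \<le> nrm (u (Suc (n + k)) - u (n + k)) + nrm (u (n + k) - u n)"
      using nrm_triangle[of "u (Suc (n + k)) - u (n + k)" "u (n + k) - u n"] u by simp
    also have "\<dots> \<le> c * q ^ (n + k) + c / (1 - q) * (q ^ n - q ^ (n + k))"
      by (intro add_mono step Suc.IH)
    also have "\<dots> = c / (1 - q) * (q ^ n - q ^ (n + Suc k))"
      using q by (simp add: field_simps)
    finally show ?case .
  qed (simp add: nrm_zero)
  from this[of "m - n"] have "nrm (u m - u n) \<le> c / (1 - q) * (q ^ n - q ^ m)" using le by simp
  also have "\<dots> \<le> c / (1 - q) * q ^ n"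
    using c q by (intro mult_left_mono) auto
  finally show ?thesis .
qed

section \<open>The nonlocal energy space\<close>

text \<open>The horizon is fixed here, so one instance of the Poincare constant suffices. No sign of
  C is assumed, hence the absolute values in later bounds.\<close>

locale nonlocal_problem =
  fixes \<Omega> :: "'a::euclidean_space set" and \<gamma>1 :: "real \<Rightarrow> real" and D0 s \<delta> C :: real
  assumes open_domain: "open \<Omega>"
    and profile: "kernel_profile TYPE('a) D0 s \<gamma>1"
    and horizon_pos: "0 < \<delta>"
    and poincare: "(v :: 'a \<Rightarrow> real) \<in> nonlocal_space \<gamma>1 \<Omega> \<delta> \<Longrightarrow>
      (LINT x:\<Omega>|lborel. (norm (v x))\<^sup>2) \<le> C * (nonlocal_norm \<gamma>1 \<Omega> \<delta> v)\<^sup>2"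
begin

abbreviation E :: "'a set" where "E \<equiv> extended_domain \<Omega> \<delta>"
abbreviation space_S :: "('a \<Rightarrow> 'b::{real_normed_vector, second_countable_topology}) set"
  where "space_S \<equiv> nonlocal_space \<gamma>1 \<Omega> \<delta>"
abbreviation norm_S :: "('a \<Rightarrow> 'b::real_normed_vector) \<Rightarrow> real"
  where "norm_S \<equiv> nonlocal_norm \<gamma>1 \<Omega> \<delta>"
abbreviation form :: "('a \<times> 'a \<Rightarrow> complex) \<Rightarrow> ('a \<Rightarrow> complex) \<Rightarrow> ('a \<Rightarrow> complex) \<Rightarrow> complex"
  where "form \<equiv> nonlocal_form \<gamma>1 \<Omega> \<delta>"

definition kernel :: "'a \<times> 'a \<Rightarrow> real" where
  "kernel p = scaled_kernel TYPE('a) \<gamma>1 \<delta> (norm (snd p - fst p))"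

text \<open>The root of the kernel is attached to each factor and the cut-off is built in, so that
  the energy norm of u is the L2 norm of \<open>incr u\<close> over all pairs and set integrals
  become plain integrals.\<close>

definition incr :: "('a \<Rightarrow> 'b::real_normed_vector) \<Rightarrow> 'a \<times> 'a \<Rightarrow> 'b" where
  "incr u p = (indicator (E \<times> E) p * sqrt (kernel p)) *\<^sub>R (u (snd p) - u (fst p))"

lemma E_borel [measurable, simp]: "E \<in> sets borel"
proof -
  have "open {x. infdist x (frontier \<Omega>) < \<delta>}"
    by (intro open_Collect_less continuous_intros)
  moreover have "E = \<Omega> \<union> (- \<Omega> \<inter> {x. infdist x (frontier \<Omega>) < \<delta>})"
    by (auto simp: interaction_domain_def)
  ultimately show ?thesis using open_domain by (metis borel_comp borel_open sets.Int sets.Un)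
qed

lemma square_borel [measurable, simp]: "E \<times> E \<in> sets borel"
  by (rule borel_Times[OF E_borel E_borel])

lemma kernel_nonneg [simp]: "0 \<le> kernel p"
  using profile horizon_pos by (simp add: kernel_def scaled_kernel_def kernel_profile_def)

text \<open>The profile is unconstrained on negative reals and need not be measurable as a function
  on the line. It is therefore replaced by an explicit \<psi> that agrees with it on nonnegative
  arguments, including its arbitrary value at 0.\<close>

lemma kernel_measurable [measurable]: "kernel \<in> borel_measurable borel"
proof -
  define \<psi> where "\<psi> r = (if r = 0 then \<gamma>1 0 else if r < 1 then D0 / r powr s else 0)" for r
  have \<psi>: "\<psi> \<in> borel_measurable borel"
    unfolding \<psi>_def[abs_def] by measurable
  have "\<gamma>1 r = \<psi> r" if "0 \<le> r" for r
    using profile that by (auto simp: kernel_profile_def \<psi>_def)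
  then have "kernel = (\<lambda>p. \<psi> (norm (snd p - fst p) / \<delta>) / \<delta> ^ (DIM('a) + 2))"
    using horizon_pos by (simp add: kernel_def[abs_def] scaled_kernel_def)
  moreover have "(\<lambda>p :: 'a \<times> 'a. norm (snd p - fst p) / \<delta>) \<in> borel_measurable borel"
    by (intro borel_measurable_continuous_onI continuous_intros) (use horizon_pos in auto)
  from measurable_compose[OF this \<psi>]
  have "(\<lambda>p :: 'a \<times> 'a. \<psi> (norm (snd p - fst p) / \<delta>) / \<delta> ^ (DIM('a) + 2)) \<in> borel_measurable borel"
    by (rule borel_measurable_divide) simp
  ultimately show ?thesis by simp
qed

text \<open>A representative may be wild off E; cutting off both values inside the difference leaves
  only measurable ingredients and changes nothing, as the outer indicator vanishes there.\<close>

lemma incr_cutoff: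
  "incr u p = (indicator (E \<times> E) p * sqrt (kernel p)) *\<^sub>R
     (indicator E (snd p) *\<^sub>R u (snd p) - indicator E (fst p) *\<^sub>R u (fst p))"
  by (cases p) (auto simp: incr_def indicator_def)

lemma incr_measurable:
  fixes u :: "'a \<Rightarrow> 'b::{real_normed_vector, second_countable_topology}"
  assumes "set_borel_measurable lborel E u"
  shows "incr u \<in> borel_measurable lborel"
proof -
  define w where "w x = indicator E x *\<^sub>R u x" for x
  have w [measurable]: "w \<in> borel_measurable borel"
    using assms unfolding set_borel_measurable_def w_def by simp
  have [measurable]: "(\<lambda>p :: 'a \<times> 'a. w (snd p)) \<in> borel_measurable borel"
    "(\<lambda>p :: 'a \<times> 'a. w (fst p)) \<in> borel_measurable borel"
    by (rule measurable_compose[OF borel_measurable_continuous_onI w], intro continuous_intros)+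
  have "(\<lambda>p. (indicator (E \<times> E) p * sqrt (kernel p)) *\<^sub>R (w (snd p) - w (fst p))) \<in> borel_measurable borel"
    by measurable
  then show ?thesis unfolding incr_cutoff[abs_def] w_def by simp
qed

lemma density_incr:
  "indicator (E \<times> E) p *\<^sub>R nonlocal_density \<gamma>1 \<delta> u p = (norm (incr u p))\<^sup>2"
  by (cases p) (auto simp: incr_def nonlocal_density_def kernel_def[symmetric] power_mult_distrib
      indicator_def, simp_all add: kernel_def)

lemma space_S_iff:
  fixes u :: "'a \<Rightarrow> 'b::{real_normed_vector, second_countable_topology}"
  shows "u \<in> space_S \<longleftrightarrow> set_borel_measurable lborel E u \<and>
    integrable lborel (\<lambda>x. (norm (indicator E x *\<^sub>R u x))\<^sup>2) \<and>
    (AE x in lborel. x \<in> interaction_domain \<Omega> \<delta> \<longrightarrow> u x = 0) \<and>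
    integrable lborel (\<lambda>p. (norm (incr u p))\<^sup>2)"
proof -
  have "indicator E x *\<^sub>R (norm (u x))\<^sup>2 = (norm (indicator E x *\<^sub>R u x))\<^sup>2" for x
    by (simp add: indicator_def)
  then show ?thesis
    unfolding nonlocal_space_def mem_Collect_eq set_integrable_def density_incr by simp
qed

lemma norm_S_square: "(norm_S u)\<^sup>2 = (\<integral>p. (norm (incr u p))\<^sup>2 \<partial>lborel)"
  unfolding nonlocal_norm_def set_lebesgue_integral_def density_incr by simp

lemma norm_S_eq: "norm_S u = sqrt (\<integral>p. (norm (incr u p))\<^sup>2 \<partial>lborel)"
  unfolding nonlocal_norm_def set_lebesgue_integral_def density_incr ..

lemma norm_S_nonneg [simp]: "0 \<le> norm_S u"
  unfolding norm_S_eq by simp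

lemma form_incr:
  "form a u v = (\<integral>p. (indicator (E \<times> E) p *\<^sub>R a p) * incr u p * cnj (incr v p) \<partial>lborel)"
proof -
  have sq: "complex_of_real (sqrt (kernel p)) * complex_of_real (sqrt (kernel p)) = complex_of_real (kernel p)" for p
    by (simp flip: of_real_mult)
  have k: "scaled_kernel TYPE('a) \<gamma>1 \<delta> (norm (x - y)) = kernel (x, y)" for x y
    by (simp add: kernel_def norm_minus_commute)
  have "indicator (E \<times> E) p *\<^sub>R (case p of (x, y) \<Rightarrow>
      a (x, y) * complex_of_real (scaled_kernel TYPE('a) \<gamma>1 \<delta> (norm (x - y))) * (u y - u x) * cnj (v y - v x))
    = (indicator (E \<times> E) p *\<^sub>R a p) * incr u p * cnj (incr v p)" for p
    by (cases p) (simp add: incr_def indicator_def scaleR_conv_of_real k sq[symmetric] mult_ac)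
  then show ?thesis unfolding nonlocal_form_def set_lebesgue_integral_def by (simp only:)
qed

lemma incr_add: "incr (u + v) p = incr u p + incr v p"
  by (simp add: incr_def scaleR_add_right scaleR_diff_right)

lemma incr_diff: "incr (u - v) p = incr u p - incr v p"
  by (simp add: incr_def scaleR_add_right scaleR_diff_right)

lemma incr_scale: "incr (\<lambda>x. c * u x) p = (c :: complex) * incr u p"
  by (simp add: incr_def scaleR_conv_of_real algebra_simps)

text \<open>Applied to \<open>Re\<close> and \<open>Im\<close>, since the Poincare inequality is assumed for real functions only.\<close>

lemma bounded_linear_space_S:
  fixes L :: "complex \<Rightarrow> real" and u :: "'a \<Rightarrow> complex"
  assumes L: "bounded_linear L" "\<And>z. \<bar>L z\<bar> \<le> cmod z" and u: "u \<in> space_S"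
  shows "(\<lambda>x. L (u x)) \<in> space_S" "incr (\<lambda>x. L (u x)) p = L (incr u p)"
    "integrable lborel (\<lambda>x. (L (indicator E x *\<^sub>R u x))\<^sup>2)" "integrable lborel (\<lambda>p. (L (incr u p))\<^sup>2)"
proof -
  note lin = linear_diff[OF bounded_linear.linear[OF L(1)]] linear_scale[OF bounded_linear.linear[OF L(1)]]
  have meas: "(\<lambda>x. L (g x)) \<in> borel_measurable lborel" if "g \<in> borel_measurable lborel"
    for g :: "'c::euclidean_space \<Rightarrow> complex"
    using that by (rule measurable_compose)
      (intro borel_measurable_continuous_onI linear_continuous_on L(1))
  have sq: "integrable lborel (\<lambda>x. (L (g x))\<^sup>2)"
    if "g \<in> borel_measurable lborel" "integrable lborel (\<lambda>x. (norm (g x))\<^sup>2)"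
    for g :: "'c::euclidean_space \<Rightarrow> complex"
  proof (rule Bochner_Integration.integrable_bound[OF that(2)])
    show "(\<lambda>x. (L (g x))\<^sup>2) \<in> borel_measurable lborel" using meas[OF that(1)] by measurable
    have "(L z)\<^sup>2 \<le> (cmod z)\<^sup>2" for z
      using power_mono[OF L(2) abs_ge_zero, of z 2] by simp
    then show "AE x in lborel. norm ((L (g x))\<^sup>2) \<le> norm ((norm (g x))\<^sup>2)" by (intro AE_I2) simp
  qed
  have u': "set_borel_measurable lborel E u" "integrable lborel (\<lambda>x. (norm (indicator E x *\<^sub>R u x))\<^sup>2)"
    "AE x in lborel. x \<in> interaction_domain \<Omega> \<delta> \<longrightarrow> u x = 0" "integrable lborel (\<lambda>p. (norm (incr u p))\<^sup>2)"
    using u by (simp_all only: space_S_iff)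
  have uE: "(\<lambda>x. indicator E x *\<^sub>R u x) \<in> borel_measurable lborel"
    using u'(1) by (simp only: set_borel_measurable_def)
  have incr_L: "incr (\<lambda>x. L (u x)) p = L (incr u p)" for p
    by (simp only: incr_def lin)
  then show "incr (\<lambda>x. L (u x)) p = L (incr u p)" .
  show i1: "integrable lborel (\<lambda>x. (L (indicator E x *\<^sub>R u x))\<^sup>2)"
    using uE u'(2) by (rule sq)
  show i2: "integrable lborel (\<lambda>p. (L (incr u p))\<^sup>2)"
    using incr_measurable[OF u'(1)] u'(4) by (rule sq)
  show "(\<lambda>x. L (u x)) \<in> space_S"
    unfolding space_S_iff
  proof (intro conjI)
    show "set_borel_measurable lborel E (\<lambda>x. L (u x))"
      using meas[OF uE] by (simp only: set_borel_measurable_def lin)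
    show "integrable lborel (\<lambda>x. (norm (indicator E x *\<^sub>R L (u x)))\<^sup>2)"
      using i1 by (simp only: lin real_norm_def power2_abs)
    show "AE x in lborel. x \<in> interaction_domain \<Omega> \<delta> \<longrightarrow> L (u x) = 0"
      using u'(3) by eventually_elim (use lin(2)[of 0 0] in simp)
    show "integrable lborel (\<lambda>p. (norm (incr (\<lambda>x. L (u x)) p))\<^sup>2)"
      using i2 by (simp only: incr_L real_norm_def power2_abs)
  qed
qed

text \<open>Squared moduli split into squares of real and imaginary parts on both sides, and
  \<open>incr\<close> commutes with \<open>Re\<close> and \<open>Im\<close>. The integral over E
  reduces to one over \<Omega> because u vanishes almost everywhere on the interaction
  domain.\<close>

lemma complex_poincare:
  fixes u :: "'a \<Rightarrow> complex"
  assumes u: "u \<in> space_S"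
  shows "(\<integral>x. (norm (indicator E x *\<^sub>R u x))\<^sup>2 \<partial>lborel) \<le> C * (norm_S u)\<^sup>2"
proof -
  note re = bounded_linear_space_S[OF bounded_linear_Re abs_Re_le_cmod u]
  note im = bounded_linear_space_S[OF bounded_linear_Im abs_Im_le_cmod u]
  have zero: "AE x in lborel. x \<in> interaction_domain \<Omega> \<delta> \<longrightarrow> u x = 0"
    using u by (simp only: space_S_iff)
  have restrict: "(\<integral>x. (L (indicator E x *\<^sub>R u x))\<^sup>2 \<partial>lborel) = (LINT x:\<Omega>|lborel. (norm (L (u x)))\<^sup>2)"
    if L: "bounded_linear L" "(\<lambda>x. L (u x)) \<in> space_S"
      "integrable lborel (\<lambda>x. (L (indicator E x *\<^sub>R u x))\<^sup>2)" for L :: "complex \<Rightarrow> real"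
  proof -
    have L0: "L 0 = 0" using L(1) by (rule linear_0[OF bounded_linear.linear])
    have "AE x in lborel. (L (indicator E x *\<^sub>R u x))\<^sup>2 = indicator \<Omega> x *\<^sub>R (norm (L (u x)))\<^sup>2"
      using zero
    proof eventually_elim
      fix x assume "x \<in> interaction_domain \<Omega> \<delta> \<longrightarrow> u x = 0"
      then show "(L (indicator E x *\<^sub>R u x))\<^sup>2 = indicator \<Omega> x *\<^sub>R (norm (L (u x)))\<^sup>2"
        using L0 by (cases "x \<in> \<Omega>"; cases "x \<in> interaction_domain \<Omega> \<delta>") auto
    qed
    moreover have "(\<lambda>x. indicator \<Omega> x *\<^sub>R (norm (L (u x)))\<^sup>2) \<in> borel_measurable lborel"
    proof -
      have [measurable]: "(\<lambda>x. indicator E x *\<^sub>R L (u x)) \<in> borel_measurable borel"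
        using L(2) by (simp add: space_S_iff set_borel_measurable_def)
      have [measurable]: "\<Omega> \<in> sets borel" using open_domain by simp
      have "(\<lambda>x. indicator \<Omega> x *\<^sub>R (norm (indicator E x *\<^sub>R L (u x)))\<^sup>2) \<in> borel_measurable borel"
        by measurable
      moreover have "(\<lambda>x. indicator \<Omega> x *\<^sub>R (norm (indicator E x *\<^sub>R L (u x)))\<^sup>2)
          = (\<lambda>x. indicator \<Omega> x *\<^sub>R (norm (L (u x)))\<^sup>2)" by (auto simp: indicator_def)
      ultimately show ?thesis by simp
    qed
    ultimately show ?thesis
      unfolding set_lebesgue_integral_def by (intro integral_cong_AE borel_measurable_integrable[OF L(3)])
  qed
  have "(\<integral>x. (norm (indicator E x *\<^sub>R u x))\<^sup>2 \<partial>lborel)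
      = (\<integral>x. (Re (indicator E x *\<^sub>R u x))\<^sup>2 + (Im (indicator E x *\<^sub>R u x))\<^sup>2 \<partial>lborel)"
    by (simp only: cmod_power2)
  also have "\<dots> = (\<integral>x. (Re (indicator E x *\<^sub>R u x))\<^sup>2 \<partial>lborel) + (\<integral>x. (Im (indicator E x *\<^sub>R u x))\<^sup>2 \<partial>lborel)"
    by (rule Bochner_Integration.integral_add[OF re(3) im(3)])
  also have "\<dots> \<le> C * (norm_S (\<lambda>x. Re (u x)))\<^sup>2 + C * (norm_S (\<lambda>x. Im (u x)))\<^sup>2"
    unfolding restrict[OF bounded_linear_Re re(1,3)] restrict[OF bounded_linear_Im im(1,3)]
    by (intro add_mono poincare re(1) im(1))
  also have "\<dots> = C * ((\<integral>p. (Re (incr u p))\<^sup>2 \<partial>lborel) + (\<integral>p. (Im (incr u p))\<^sup>2 \<partial>lborel))"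
    unfolding norm_S_square re(2) im(2) by (simp only: real_norm_def power2_abs distrib_left)
  also have "(\<integral>p. (Re (incr u p))\<^sup>2 \<partial>lborel) + (\<integral>p. (Im (incr u p))\<^sup>2 \<partial>lborel) = (norm_S u)\<^sup>2"
    unfolding norm_S_square cmod_power2 by (rule Bochner_Integration.integral_add[OF re(4) im(4), symmetric])
  finally show ?thesis .
qed

text \<open>Identifies the null vectors of the seminorm, turning uniqueness up to seminorm zero into
  uniqueness almost everywhere.\<close>

lemma norm_S_zero_imp_AE:
  fixes u :: "'a \<Rightarrow> complex"
  assumes u: "u \<in> space_S" "norm_S u = 0"
  shows "AE x in lborel. x \<in> E \<longrightarrow> u x = 0"
proof -
  have int: "integrable lborel (\<lambda>x. (norm (indicator E x *\<^sub>R u x))\<^sup>2)"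
    using u(1) by (simp only: space_S_iff)
  have "(\<integral>x. (norm (indicator E x *\<^sub>R u x))\<^sup>2 \<partial>lborel) = 0"
    using complex_poincare[OF u(1)] u(2) by (intro antisym integral_nonneg) auto
  then have "AE x in lborel. (norm (indicator E x *\<^sub>R u x))\<^sup>2 = 0"
    using integral_nonneg_eq_0_iff_AE[OF int] by simp
  then show ?thesis by eventually_elim (auto simp: indicator_def)
qed

section \<open>Forms induced by bounded coefficients\<close>

definition coefficient_bound :: "('a \<times> 'a \<Rightarrow> complex) \<Rightarrow> real \<Rightarrow> bool" where
  "coefficient_bound a K \<longleftrightarrow> 0 \<le> K \<and> set_borel_measurable lborel (E \<times> E) a \<and>
     (AE p in lborel. p \<in> E \<times> E \<longrightarrow> cmod (a p) \<le> K)"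

lemma space_S_D:
  fixes u :: "'a \<Rightarrow> complex"
  assumes "u \<in> space_S"
  shows "(\<lambda>x. indicator E x *\<^sub>R u x) \<in> borel_measurable lborel"
    "integrable lborel (\<lambda>x. (norm (indicator E x *\<^sub>R u x))\<^sup>2)"
    "AE x in lborel. x \<in> interaction_domain \<Omega> \<delta> \<longrightarrow> u x = 0"
    "integrable lborel (\<lambda>p. (norm (incr u p))\<^sup>2)" "incr u \<in> borel_measurable lborel"
  using assms incr_measurable[of u] by (simp_all only: space_S_iff set_borel_measurable_def)

lemma vector_space_fun: "vector_space (\<lambda>c (u :: 'a \<Rightarrow> complex) x. c * u x)"
  by unfold_locales (auto simp: fun_eq_iff algebra_simps)

lemma complex_subspace_S: "complex_subspace (\<lambda>c (u :: 'a \<Rightarrow> complex) x. c * u x) space_S"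
proof -
  interpret vector_space "\<lambda>c (u :: 'a \<Rightarrow> complex) x. c * u x" by (rule vector_space_fun)
  have zero: "(0 :: 'a \<Rightarrow> complex) \<in> space_S"
    unfolding space_S_iff by (simp add: set_borel_measurable_def incr_def)
  have add: "u + v \<in> space_S" if "u \<in> space_S" "v \<in> space_S" for u v :: "'a \<Rightarrow> complex"
  proof -
    note u = space_S_D[OF that(1)] and v = space_S_D[OF that(2)]
    show ?thesis
      unfolding space_S_iff set_borel_measurable_def incr_add plus_fun_apply scaleR_add_right
    proof (intro conjI)
      show "AE x in lborel. x \<in> interaction_domain \<Omega> \<delta> \<longrightarrow> u x + v x = 0"
        using u(3) v(3) by eventually_elim simp
    qed (rule borel_measurable_add[OF u(1) v(1)] integrable_norm_square_add[OF u(1) v(1) u(2) v(2)]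
        integrable_norm_square_add[OF u(5) v(5) u(4) v(4)])+
  qed
  have scale: "(\<lambda>x. c * u x) \<in> space_S" if "u \<in> space_S" for c and u :: "'a \<Rightarrow> complex"
  proof -
    note u = space_S_D[OF that]
    show ?thesis
      unfolding space_S_iff set_borel_measurable_def incr_scale mult_scaleR_right[symmetric]
        norm_mult power_mult_distrib
    proof (intro conjI)
      show "(\<lambda>x. c * (indicator E x *\<^sub>R u x)) \<in> borel_measurable lborel"
        by (rule borel_measurable_times[OF borel_measurable_const u(1)])
      show "AE x in lborel. x \<in> interaction_domain \<Omega> \<delta> \<longrightarrow> c * u x = 0"
        using u(3) by eventually_elim simp
    qed (intro integrable_mult_right u(2,4))+
  qed
  show ?thesis
    by (intro complex_subspace.intro vector_space_fun complex_subspace_axioms.intro subspaceI zero add scale)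
qed

lemma form_integrable:
  assumes a: "coefficient_bound a K" and u: "u \<in> space_S" and v: "v \<in> space_S"
  shows "integrable lborel (\<lambda>p. (indicator (E \<times> E) p *\<^sub>R a p) * incr u p * cnj (incr v p))"
    "cmod (form a u v) \<le> K * norm_S u * norm_S v"
proof -
  have a': "(\<lambda>p. indicator (E \<times> E) p *\<^sub>R a p) \<in> borel_measurable lborel" "0 \<le> K"
    "AE p in lborel. p \<in> E \<times> E \<longrightarrow> cmod (a p) \<le> K"
    using a by (simp_all only: coefficient_bound_def set_borel_measurable_def)
  have bound: "AE p in lborel. cmod (indicator (E \<times> E) p *\<^sub>R a p) \<le> K"
    using a'(3)
  proof eventually_elim
    fix p assume "p \<in> E \<times> E \<longrightarrow> cmod (a p) \<le> K"
    then show "cmod (indicator (E \<times> E) p *\<^sub>R a p) \<le> K"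
      using a'(2) by (cases "p \<in> E \<times> E") simp_all
  qed
  note product = L2_weighted_product[OF a'(1) space_S_D(5)[OF u] space_S_D(5)[OF v]
      space_S_D(4)[OF u] space_S_D(4)[OF v] bound a'(2)]
  show "integrable lborel (\<lambda>p. (indicator (E \<times> E) p *\<^sub>R a p) * incr u p * cnj (incr v p))"
    by (rule product(1))
  show "cmod (form a u v) \<le> K * norm_S u * norm_S v"
    unfolding form_incr norm_S_eq by (rule product(2))
qed

lemma form_bounded: "coefficient_bound a K \<Longrightarrow> bounded_form_on space_S norm_S K (form a)"
  unfolding bounded_form_on_def by (intro ballI form_integrable(2))

lemma form_sesquilinear:
  assumes a: "coefficient_bound a K"
  shows "sesquilinear_on (\<lambda>c u x. c * u x) space_S (form a)"
proof -
  note int = form_integrable(1)[OF a]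
  have "form a (x + y) v = form a x v + form a y v"
    if "x \<in> space_S" "y \<in> space_S" "v \<in> space_S" for x y v
    unfolding form_incr incr_add
    using Bochner_Integration.integral_add[OF int[OF that(1,3)] int[OF that(2,3)]]
    by (simp only: distrib_left distrib_right)
  moreover have "form a u (x + y) = form a u x + form a u y"
    if "x \<in> space_S" "y \<in> space_S" "u \<in> space_S" for x y u
    unfolding form_incr incr_add complex_cnj_add
    using Bochner_Integration.integral_add[OF int[OF that(3,1)] int[OF that(3,2)]]
    by (simp only: distrib_left distrib_right)
  moreover have "form a (\<lambda>x. c * u x) v = c * form a u v" for c u v
    unfolding form_incr incr_scale integral_mult_right_zero[symmetric] by (simp only: mult_ac)
  moreover have "form a u (\<lambda>x. c * v x) = cnj c * form a u v" for c u v
    unfolding form_incr incr_scale integral_mult_right_zero[symmetric] complex_cnj_mult by (simp only: mult_ac)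
  ultimately show ?thesis
    by (simp add: sesquilinear_on_def conjugate_linear_on_def)
qed

lemma form_coercive:
  assumes a: "coefficient_bound a K" and r: "AE p in lborel. p \<in> E \<times> E \<longrightarrow> r \<le> Re (a p)"
  shows "coercive_on space_S norm_S r (form a)"
  unfolding coercive_on_def
proof
  fix v :: "'a \<Rightarrow> complex" assume v: "v \<in> space_S"
  let ?g = "\<lambda>p. (indicator (E \<times> E) p *\<^sub>R a p) * incr v p * cnj (incr v p)"
  have "r * (norm_S v)\<^sup>2 = (\<integral>p. r * (norm (incr v p))\<^sup>2 \<partial>lborel)"
    unfolding norm_S_square by simp
  also have "\<dots> \<le> (\<integral>p. Re (?g p) \<partial>lborel)"
  proof (rule integral_mono_AE)
    show "integrable lborel (\<lambda>p. r * (norm (incr v p))\<^sup>2)"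
      using space_S_D(4)[OF v] by simp
    show "integrable lborel (\<lambda>p. Re (?g p))"
      using form_integrable(1)[OF a v v] by (rule integrable_Re)
    show "AE p in lborel. r * (norm (incr v p))\<^sup>2 \<le> Re (?g p)"
      using r
    proof eventually_elim
      fix p assume r: "p \<in> E \<times> E \<longrightarrow> r \<le> Re (a p)"
      show "r * (norm (incr v p))\<^sup>2 \<le> Re (?g p)"
      proof (cases "p \<in> E \<times> E")
        case True
        have "?g p = a p * complex_of_real ((norm (incr v p))\<^sup>2)"
          unfolding complex_norm_square using True by (simp add: mult.assoc)
        then have "Re (?g p) = Re (a p) * (norm (incr v p))\<^sup>2" by (simp only: Re_complex_of_real
              Im_complex_of_real times_complex.sel mult_zero_right diff_zero)
        then show ?thesis using r True by (simp only: mult_right_mono zero_le_power2)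
      next
        case False
        then have "incr v p = 0" by (simp add: incr_def)
        then show ?thesis by simp
      qed
    qed
  qed
  also have "\<dots> = Re (form a v v)"
    unfolding form_incr by (rule integral_Re[OF form_integrable(1)[OF a v v]])
  finally show "r * (norm_S v)\<^sup>2 \<le> Re (form a v v)" .
qed

lemma coefficient_bound_one: "coefficient_bound (\<lambda>_. 1) 1"
  unfolding coefficient_bound_def set_borel_measurable_def
  by (simp add: borel_measurable_indicator)

text \<open>The energy inner product is the form of the constant coefficient 1, so its
  sesquilinearity is a special case of the general one.\<close>

lemma semi_inner_space_S:
  "semi_inner_space (\<lambda>c (u :: 'a \<Rightarrow> complex) x. c * u x) space_S (form (\<lambda>_. 1)) norm_S"
proof (intro semi_inner_space.intro complex_subspace_S semi_inner_space_axioms.intro)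
  show "sesquilinear_on (\<lambda>c u x. c * u x) space_S (form (\<lambda>_. 1))"
    by (rule form_sesquilinear[OF coefficient_bound_one])
  show "form (\<lambda>_. 1) v u = cnj (form (\<lambda>_. 1) u v)" for u v :: "'a \<Rightarrow> complex"
    unfolding form_incr Bochner_Integration.integral_cnj[symmetric]
    by (simp add: mult_ac)
  show "form (\<lambda>_. 1) u u = complex_of_real ((norm_S u)\<^sup>2)" for u :: "'a \<Rightarrow> complex"
  proof -
    have "(indicator (E \<times> E) p *\<^sub>R 1) * incr u p * cnj (incr u p) = complex_of_real ((norm (incr u p))\<^sup>2)" for p
      unfolding complex_norm_square by (cases "p \<in> E \<times> E") (simp_all add: incr_def)
    then show ?thesis unfolding form_incr norm_S_square by (simp only: integral_complex_of_real)
  qed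
qed simp

end

sublocale nonlocal_problem \<subseteq> S: semi_inner_space "\<lambda>c (u :: 'a \<Rightarrow> complex) x. c * u x"
  space_S "form (\<lambda>_. 1)" norm_S
  by (rule semi_inner_space_S)

text \<open>Poincare makes the L2 increments geometric too, so the cut-off functions converge almost
  everywhere. Fatou on E bounds the limit in L2, and Fatou on pairs shows that its energy is finite
  and that the convergence holds in energy.\<close>

lemma (in nonlocal_problem) space_S_complete:
  fixes u :: "nat \<Rightarrow> 'a \<Rightarrow> complex"
  assumes u: "\<And>n. u n \<in> space_S" and q: "0 < q" "q < 1"
    and step: "\<And>n. norm_S (u (Suc n) - u n) \<le> c * q ^ n"
  shows "\<exists>l\<in>space_S. (\<lambda>n. norm_S (u n - l)) \<longlonglongrightarrow> 0"
proof -
  define uE where "uE n x = indicator E x *\<^sub>R u n x" for n x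
  \<comment> \<open>Where the sequence diverges the value is arbitrary; off E all terms are 0, so l
    is already cut off.\<close>
  define l where "l x = lim (\<lambda>n. uE n x)" for x
  note D = space_S_D[OF u] and DD = space_S_D[OF S.V_closed(3)[OF u u]]
  have uE_meas: "uE n \<in> borel_measurable lborel" for n
    using D(1)[of n] by (simp only: uE_def[abs_def])
  have l_meas: "l \<in> borel_measurable lborel"
    unfolding l_def[abs_def] by (rule borel_measurable_lim_metric[OF uE_meas])
  have l_E: "indicator E x *\<^sub>R l x = l x" for x
    by (cases "x \<in> E") (simp_all add: l_def uE_def)
  have "AE x in lborel. summable (\<lambda>n. uE (Suc n) x - uE n x)"
  proof (rule AE_summable_of_geometric_L2)
    fix n
    have eq: "uE (Suc n) x - uE n x = indicator E x *\<^sub>R (u (Suc n) - u n) x" for x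
      by (simp add: uE_def scaleR_diff_right)
    show "(\<lambda>x. uE (Suc n) x - uE n x) \<in> borel_measurable lborel"
      "integrable lborel (\<lambda>x. (norm (uE (Suc n) x - uE n x))\<^sup>2)"
      unfolding eq by (rule DD)+
    have "(\<integral>x. (norm (uE (Suc n) x - uE n x))\<^sup>2 \<partial>lborel) \<le> C * (norm_S (u (Suc n) - u n))\<^sup>2"
      unfolding eq using u by (intro complex_poincare S.V_closed)
    also have "\<dots> \<le> \<bar>C\<bar> * (c * q ^ n)\<^sup>2"
      using step[of n] by (intro mult_mono power_mono) auto
    finally show "(\<integral>x. (norm (uE (Suc n) x - uE n x))\<^sup>2 \<partial>lborel) \<le> (\<bar>C\<bar> * c\<^sup>2) * (q ^ n)\<^sup>2"
      by (simp add: power_mult_distrib mult.assoc)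
  qed (use q in auto)
  then have lim: "AE x in lborel. (\<lambda>n. uE n x) \<longlonglongrightarrow> l x"
  proof eventually_elim
    fix x assume "summable (\<lambda>n. uE (Suc n) x - uE n x)"
    then have "(\<lambda>n. \<Sum>k<n. uE (Suc k) x - uE k x) \<longlonglongrightarrow> (\<Sum>k. uE (Suc k) x - uE k x)"
      by (rule summable_LIMSEQ)
    then have "(\<lambda>n. uE n x - uE 0 x) \<longlonglongrightarrow> (\<Sum>k. uE (Suc k) x - uE k x)"
      using sum_lessThan_telescope[of "\<lambda>k. uE k x"] by simp
    from tendsto_add[OF this tendsto_const[of "uE 0 x"]] have "convergent (\<lambda>n. uE n x)"
      by (auto simp: convergent_def)
    then show "(\<lambda>n. uE n x) \<longlonglongrightarrow> l x"
      unfolding l_def by (simp only: convergent_LIMSEQ_iff)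
  qed
  have incr_lim: "AE p in lborel. (\<lambda>n. incr (u n) p) \<longlonglongrightarrow> incr l p"
    using AE_lborel_pair[OF lim]
  proof eventually_elim
    fix p :: "'a \<times> 'a"
    assume "(\<lambda>n. uE n (fst p)) \<longlonglongrightarrow> l (fst p) \<and> (\<lambda>n. uE n (snd p)) \<longlonglongrightarrow> l (snd p)"
    then show "(\<lambda>n. incr (u n) p) \<longlonglongrightarrow> incr l p"
      unfolding incr_cutoff l_E uE_def by (intro tendsto_intros) auto
  qed
  have incr_l_meas: "incr l \<in> borel_measurable lborel"
    using l_meas by (intro incr_measurable) (simp only: set_borel_measurable_def l_E)
  define R where "R = norm_S (u 0) + c / (1 - q)"
  have bounded: "(norm_S (u n))\<^sup>2 \<le> R\<^sup>2" for n
  proof (rule power_mono)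
    have "norm_S (u n) \<le> norm_S (u n - u 0) + norm_S (u 0)"
      using S.nrm_triangle[OF S.V_closed(3)[OF u u] u, of n 0 0] by simp
    also have "norm_S (u n - u 0) \<le> c / (1 - q)"
      using S.geometric_increments[OF u q step, of 0 n] by simp
    finally show "norm_S (u n) \<le> R" by (simp add: R_def)
  qed simp
  have "l \<in> space_S"
    unfolding space_S_iff set_borel_measurable_def l_E
  proof (intro conjI)
    show "l \<in> borel_measurable lborel" by (rule l_meas)
    show "integrable lborel (\<lambda>x. (norm (l x))\<^sup>2)"
    proof (rule L2_fatou(1)[OF uE_meas l_meas _ _ lim])
      show "integrable lborel (\<lambda>x. (norm (uE n x))\<^sup>2)" for n
        using D(2)[of n] by (simp only: uE_def)
      have "(\<integral>x. (norm (uE n x))\<^sup>2 \<partial>lborel) \<le> \<bar>C\<bar> * R\<^sup>2" for n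
      proof -
        have "(\<integral>x. (norm (uE n x))\<^sup>2 \<partial>lborel) \<le> C * (norm_S (u n))\<^sup>2"
          unfolding uE_def by (rule complex_poincare[OF u])
        also have "\<dots> \<le> \<bar>C\<bar> * R\<^sup>2"
          using bounded[of n] by (intro mult_mono) auto
        finally show ?thesis .
      qed
      then show "\<forall>\<^sub>F n in sequentially. (\<integral>x. (norm (uE n x))\<^sup>2 \<partial>lborel) \<le> \<bar>C\<bar> * R\<^sup>2"
        by (intro always_eventually allI)
    qed
    \<comment> \<open>The exceptional null sets, one for each n, are united into a single
      one.\<close>
    have "AE x in lborel. \<forall>n. x \<in> interaction_domain \<Omega> \<delta> \<longrightarrow> u n x = 0"
      using D(3) by (simp only: AE_all_countable) blast
    then show "AE x in lborel. x \<in> interaction_domain \<Omega> \<delta> \<longrightarrow> l x = 0"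
      by eventually_elim (simp add: l_def uE_def)
    show "integrable lborel (\<lambda>p. (norm (incr l p))\<^sup>2)"
    proof (rule L2_fatou(1)[OF D(5) incr_l_meas D(4) _ incr_lim])
      show "\<forall>\<^sub>F n in sequentially. (\<integral>p. (norm (incr (u n) p))\<^sup>2 \<partial>lborel) \<le> R\<^sup>2"
        using bounded unfolding norm_S_square by (intro always_eventually allI)
    qed
  qed
  note l = this
  have bound: "norm_S (u n - l) \<le> c / (1 - q) * q ^ n" for n
  proof (rule power2_le_imp_le)
    show "(norm_S (u n - l))\<^sup>2 \<le> (c / (1 - q) * q ^ n)\<^sup>2"
      unfolding norm_S_square
    \<comment> \<open>Here n is fixed and m tends to infinity in u n - u m, whose norm is bounded
      for all m \<ge> n.\<close>
    proof (rule L2_fatou(2)[OF DD(5) space_S_D(5)[OF S.V_closed(3)[OF u l]] DD(4)])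
      show "AE p in lborel. (\<lambda>m. incr (u n - u m) p) \<longlonglongrightarrow> incr (u n - l) p"
        using incr_lim by eventually_elim (simp only: incr_diff, intro tendsto_intros)
      have "(norm_S (u n - u m))\<^sup>2 \<le> (c / (1 - q) * q ^ n)\<^sup>2" if "n \<le> m" for m
        using S.geometric_increments[OF u q step that] S.nrm_diff_commute[OF u u, of n m]
        by (intro power_mono) auto
      then show "\<forall>\<^sub>F m in sequentially. (\<integral>p. (norm (incr (u n - u m) p))\<^sup>2 \<partial>lborel) \<le> (c / (1 - q) * q ^ n)\<^sup>2"
        unfolding norm_S_square eventually_sequentially by blast
    qed
    have "0 \<le> c" using order_trans[OF norm_S_nonneg step[of 0]] by simp
    then show "0 \<le> c / (1 - q) * q ^ n" using q by simp
  qed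
  have "(\<lambda>n. norm_S (u n - l)) \<longlonglongrightarrow> 0"
  proof (rule Lim_null_comparison)
    show "\<forall>\<^sub>F n in sequentially. norm (norm_S (u n - l)) \<le> c / (1 - q) * q ^ n"
      using bound by (intro always_eventually allI) simp
    show "(\<lambda>n. c / (1 - q) * q ^ n) \<longlonglongrightarrow> 0"
      using q by (intro tendsto_mult_right_zero LIMSEQ_power_zero) simp
  qed
  then show ?thesis using l by blast
qed

sublocale nonlocal_problem \<subseteq> S: semi_hilbert_space "\<lambda>c (u :: 'a \<Rightarrow> complex) x. c * u x"
  space_S "form (\<lambda>_. 1)" norm_S
  by unfold_locales (rule space_S_complete)

section \<open>Essentially bounded coefficients\<close>

lemma Linf_measurable_iff:
  fixes a :: "'a::euclidean_space \<Rightarrow> complex"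
  assumes "Q \<in> sets borel"
  shows "set_borel_measurable lborel Q a \<longleftrightarrow> a \<in> borel_measurable (restrict_space lborel Q)"
  using assms by (subst borel_measurable_restrict_space_iff) (auto simp: set_borel_measurable_def)

lemma Linf_norm_AE:
  assumes Q: "Q \<in> sets borel" and a: "a \<in> Linf_space Q"
  shows "AE p in lborel. p \<in> Q \<longrightarrow> cmod (a p) \<le> Linf_norm Q a"
proof -
  have "AE p in restrict_space lborel Q. ereal (cmod (a p)) \<le> Linf_esssup Q a"
    unfolding Linf_esssup_def by (rule esssup_AE)
  then have "AE p in lborel. p \<in> Q \<longrightarrow> ereal (cmod (a p)) \<le> Linf_esssup Q a"
    using Q by (subst (asm) AE_restrict_space_iff) auto
  then show ?thesis
  proof eventually_elim
    fix p assume *: "p \<in> Q \<longrightarrow> ereal (cmod (a p)) \<le> Linf_esssup Q a"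
    \<comment> \<open>\<open>real_of_ereal\<close> sends both infinities to 0. Plus infinity is
      excluded by membership in the space; minus infinity cannot dominate a modulus, so in that case
      p lies outside Q.\<close>
    have "Linf_esssup Q a < \<infinity>" using a by (simp add: Linf_space_def)
    then show "p \<in> Q \<longrightarrow> cmod (a p) \<le> Linf_norm Q a"
      using * unfolding Linf_norm_def by (cases "Linf_esssup Q a") auto
  qed
qed

lemma Linf_spaceI:
  assumes Q: "Q \<in> sets borel" and a: "set_borel_measurable lborel Q a"
    and K: "AE p in lborel. p \<in> Q \<longrightarrow> cmod (a p) \<le> K"
  shows "a \<in> Linf_space Q"
proof -
  have [measurable]: "a \<in> borel_measurable (restrict_space lborel Q)"
    using a Linf_measurable_iff[OF Q] by simp
  have "AE p in restrict_space lborel Q. ereal (cmod (a p)) \<le> ereal K"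
    using K Q by (subst AE_restrict_space_iff) auto
  then have "Linf_esssup Q a \<le> ereal K"
    unfolding Linf_esssup_def by (intro esssup_I) measurable
  then have "Linf_esssup Q a < \<infinity>" by (rule le_less_trans) simp
  then show ?thesis using a by (simp add: Linf_space_def)
qed

lemma Linf_space_measurable: "a \<in> Linf_space Q \<Longrightarrow> set_borel_measurable lborel Q a"
  by (simp add: Linf_space_def)

lemma Linf_space_diff:
  assumes Q: "Q \<in> sets borel" and a: "a \<in> Linf_space Q" and b: "b \<in> Linf_space Q"
  shows "(\<lambda>p. a p - b p) \<in> Linf_space Q"
proof (rule Linf_spaceI[OF Q])
  show "set_borel_measurable lborel Q (\<lambda>p. a p - b p)"
    using Linf_space_measurable[OF a] Linf_space_measurable[OF b]
    unfolding set_borel_measurable_def scaleR_diff_right by (rule borel_measurable_diff)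
  show "AE p in lborel. p \<in> Q \<longrightarrow> cmod (a p - b p) \<le> Linf_norm Q a + Linf_norm Q b"
    using Linf_norm_AE[OF Q a] Linf_norm_AE[OF Q b]
  proof eventually_elim
    fix p assume "p \<in> Q \<longrightarrow> cmod (a p) \<le> Linf_norm Q a" "p \<in> Q \<longrightarrow> cmod (b p) \<le> Linf_norm Q b"
    then show "p \<in> Q \<longrightarrow> cmod (a p - b p) \<le> Linf_norm Q a + Linf_norm Q b"
      using norm_triangle_ineq4[of "a p" "b p"] by auto
  qed
qed

lemma Linf_space_lincomb:
  fixes D :: "'i::finite \<Rightarrow> 'a::euclidean_space \<Rightarrow> complex"
  assumes Q: "Q \<in> sets borel" and D: "\<And>i. D i \<in> Linf_space Q"
  shows "(\<lambda>p. \<Sum>i\<in>UNIV. c i * D i p) \<in> Linf_space Q"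
    "AE p in lborel. p \<in> Q \<longrightarrow> cmod (\<Sum>i\<in>UNIV. c i * D i p) \<le> (\<Sum>i\<in>UNIV. cmod (c i) * \<bar>Linf_norm Q (D i)\<bar>)"
proof -
  have "AE p in lborel. \<forall>i\<in>UNIV. p \<in> Q \<longrightarrow> cmod (D i p) \<le> Linf_norm Q (D i)"
    using Linf_norm_AE[OF Q D] by (intro AE_finite_allI) auto
  then show bound: "AE p in lborel. p \<in> Q \<longrightarrow>
      cmod (\<Sum>i\<in>UNIV. c i * D i p) \<le> (\<Sum>i\<in>UNIV. cmod (c i) * \<bar>Linf_norm Q (D i)\<bar>)"
  proof eventually_elim
    fix p assume p: "\<forall>i\<in>UNIV. p \<in> Q \<longrightarrow> cmod (D i p) \<le> Linf_norm Q (D i)"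
    show "p \<in> Q \<longrightarrow> cmod (\<Sum>i\<in>UNIV. c i * D i p) \<le> (\<Sum>i\<in>UNIV. cmod (c i) * \<bar>Linf_norm Q (D i)\<bar>)"
    proof (intro impI sum_norm_le)
      fix i assume "p \<in> Q"
      then have "cmod (D i p) \<le> Linf_norm Q (D i)" using p by blast
      then have "cmod (D i p) \<le> \<bar>Linf_norm Q (D i)\<bar>" by linarith
      then show "norm (c i * D i p) \<le> cmod (c i) * \<bar>Linf_norm Q (D i)\<bar>"
        by (simp only: norm_mult mult_left_mono norm_ge_zero)
    qed
  qed
  have "set_borel_measurable lborel Q (\<lambda>p. \<Sum>i\<in>UNIV. c i * D i p)"
    unfolding set_borel_measurable_def scaleR_sum_right mult_scaleR_right[symmetric]
    using Linf_space_measurable[OF D, unfolded set_borel_measurable_def]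
    by (intro borel_measurable_sum borel_measurable_times borel_measurable_const)
  from Linf_spaceI[OF Q this bound] show "(\<lambda>p. \<Sum>i\<in>UNIV. c i * D i p) \<in> Linf_space Q" .
qed

text \<open>Differentiability at z yields |A \<xi> - A z| \<le> |h| (1 + M) almost everywhere for h
  = \<xi> - z small, with M the sum of the norms of the D i. The real part cannot drop by more than
  that.\<close>

lemma holomorphic_Linf_lower_bound:
  fixes A :: "complex ^ 'n::finite \<Rightarrow> 'a::euclidean_space \<Rightarrow> complex"
  assumes Q: "Q \<in> sets borel" and A: "holomorphic_map_on (Linf_space Q) (Linf_norm Q) A UNIV"
    and z: "AE p in lborel. p \<in> Q \<longrightarrow> r \<le> Re (A z p)" and r': "r' < r"
  shows "\<exists>e>0. \<forall>\<xi>\<in>ball z e. AE p in lborel. p \<in> Q \<longrightarrow> r' \<le> Re (A \<xi> p)"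
proof -
  obtain D where D: "\<And>i. D i \<in> Linf_space Q"
    and lim: "((\<lambda>h. Linf_norm Q (\<lambda>p. A (z + h) p - A z p - (\<Sum>i\<in>UNIV. h $ i * D i p)) / norm h) \<longlongrightarrow> 0) (at 0)"
    using A unfolding holomorphic_map_on_def by blast
  have A_Linf: "A \<xi> \<in> Linf_space Q" for \<xi> using A by (simp add: holomorphic_map_on_def)
  let ?R = "\<lambda>h p. A (z + h) p - A z p - (\<Sum>i\<in>UNIV. h $ i * D i p)"
  define M where "M = (\<Sum>i\<in>UNIV. \<bar>Linf_norm Q (D i)\<bar>)"
  have M: "0 \<le> M" by (simp add: M_def sum_nonneg)
  have "\<forall>\<^sub>F h in at 0. Linf_norm Q (?R h) / norm h < 1"
    using lim by (rule order_tendstoD) simp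
  then obtain e1 where e1: "0 < e1" "\<And>h. h \<noteq> 0 \<Longrightarrow> norm h < e1 \<Longrightarrow> Linf_norm Q (?R h) / norm h < 1"
    by (auto simp: eventually_at)
  \<comment> \<open>Inside e1 the remainder is at most |h|, the 1 in 1 + M; the second entry keeps
    |h| (1 + M) below the admissible loss r - r'.\<close>
  define e where "e = min e1 ((r - r') / (1 + M))"
  have e: "0 < e" using e1(1) r' M by (simp add: e_def)
  have "AE p in lborel. p \<in> Q \<longrightarrow> r' \<le> Re (A \<xi> p)" if "\<xi> \<in> ball z e" for \<xi>
  proof (cases "\<xi> = z")
    case True
    show ?thesis unfolding True using z by eventually_elim (use r' in auto)
  next
    case False
    define h where "h = \<xi> - z"
    have h: "h \<noteq> 0" "norm h < e1" "norm h < (r - r') / (1 + M)" "z + h = \<xi>"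
      using that False by (auto simp: h_def e_def dist_norm norm_minus_commute)
    have R: "Linf_norm Q (?R h) \<le> norm h"
      using e1(2)[OF h(1,2)] h(1) by (simp add: divide_less_eq)
    have hM: "norm h * (1 + M) \<le> r - r'"
      using h(3) M by (simp add: less_divide_eq add_nonneg_pos)
    have L: "(\<Sum>i\<in>UNIV. cmod (h $ i) * \<bar>Linf_norm Q (D i)\<bar>) \<le> norm h * M"
      unfolding M_def sum_distrib_left
      by (intro sum_mono mult_right_mono Finite_Cartesian_Product.norm_nth_le) auto
    have "?R h \<in> Linf_space Q"
      by (intro Linf_space_diff Q A_Linf Linf_space_lincomb D)
    from Linf_norm_AE[OF Q this] Linf_space_lincomb(2)[OF Q D, where c="\<lambda>i. h $ i"] z
    show ?thesis
    proof eventually_elim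
      fix p
      assume b: "p \<in> Q \<longrightarrow> cmod (?R h p) \<le> Linf_norm Q (?R h)"
        "p \<in> Q \<longrightarrow> cmod (\<Sum>i\<in>UNIV. h $ i * D i p) \<le> (\<Sum>i\<in>UNIV. cmod (h $ i) * \<bar>Linf_norm Q (D i)\<bar>)"
        "p \<in> Q \<longrightarrow> r \<le> Re (A z p)"
      show "p \<in> Q \<longrightarrow> r' \<le> Re (A \<xi> p)"
      proof
        assume p: "p \<in> Q"
        have "cmod (A \<xi> p - A z p) \<le> cmod (?R h p) + cmod (\<Sum>i\<in>UNIV. h $ i * D i p)"
          using norm_triangle_ineq[of "?R h p" "\<Sum>i\<in>UNIV. h $ i * D i p"] h(4) by simp
        also have "\<dots> \<le> norm h * (1 + M)"
          unfolding distrib_left using b(1,2) p R L by simp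
        finally have "cmod (A \<xi> p - A z p) \<le> r - r'" using hM by linarith
        then show "r' \<le> Re (A \<xi> p)"
          using b(3) p abs_Re_le_cmod[of "A \<xi> p - A z p"] by simp
      qed
    qed
  qed
  then show ?thesis using e by blast
qed

section \<open>Dependence of the form and of the solution on the coefficient\<close>

context nonlocal_problem
begin

abbreviation Linf_S :: "('a \<times> 'a \<Rightarrow> complex) set" where "Linf_S \<equiv> Linf_space (E \<times> E)"

lemma Linf_coefficient_bound:
  assumes "a \<in> Linf_S"
  \<comment> \<open>The absolute value supplies the required sign without examining the essential
    supremum.\<close>
  shows "coefficient_bound a \<bar>Linf_norm (E \<times> E) a\<bar>"
proof -
  have "AE p in lborel. p \<in> E \<times> E \<longrightarrow> cmod (a p) \<le> \<bar>Linf_norm (E \<times> E) a\<bar>"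
    using Linf_norm_AE[OF square_borel assms] by eventually_elim linarith
  then show ?thesis
    using Linf_space_measurable[OF assms] by (simp only: coefficient_bound_def abs_ge_zero simp_thms)
qed

lemmas Linf_form_integrable = form_integrable(1)[OF Linf_coefficient_bound]

lemma form_diff_coefficient:
  assumes "a \<in> Linf_S" "b \<in> Linf_S" "u \<in> space_S" "v \<in> space_S"
  shows "form (\<lambda>p. a p - b p) u v = form a u v - form b u v"
  unfolding form_incr scaleR_diff_right left_diff_distrib
  using assms by (intro Bochner_Integration.integral_diff Linf_form_integrable)

lemma form_lincomb_coefficient:
  fixes D :: "'i::finite \<Rightarrow> 'a \<times> 'a \<Rightarrow> complex"
  assumes "\<And>i. D i \<in> Linf_S" "u \<in> space_S" "v \<in> space_S"
  shows "form (\<lambda>p. \<Sum>i\<in>UNIV. c i * D i p) u v = (\<Sum>i\<in>UNIV. c i * form (D i) u v)"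
proof -
  have "form (\<lambda>p. \<Sum>i\<in>UNIV. c i * D i p) u v
      = (\<integral>p. (\<Sum>i\<in>UNIV. c i * ((indicator (E \<times> E) p *\<^sub>R D i p) * incr u p * cnj (incr v p))) \<partial>lborel)"
    unfolding form_incr scaleR_sum_right sum_distrib_right mult_scaleR_right[symmetric]
    by (simp only: mult.assoc)
  also have "\<dots> = (\<Sum>i\<in>UNIV. c i * form (D i) u v)"
    unfolding form_incr integral_mult_right_zero[symmetric]
    using assms by (intro Bochner_Integration.integral_sum integrable_mult_right Linf_form_integrable)
  finally show ?thesis .
qed

lemma dual_functional:
  assumes "f \<in> conjugate_linear_dual space_S norm_S"
  shows "conjugate_linear_on (\<lambda>c u x. c * u x) space_S f" "bounded_functional_on space_S norm_S f"
  using assms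
  unfolding conjugate_linear_dual_def conjugate_linear_on_def bounded_functional_on_def plus_fun_def
  by blast+

lemma uniquely_solvable_coercive:
  assumes a: "a \<in> Linf_S" and r: "0 < r" "AE p in lborel. p \<in> E \<times> E \<longrightarrow> r \<le> Re (a p)"
    and f: "f \<in> conjugate_linear_dual space_S norm_S"
  shows "uniquely_solvable \<gamma>1 \<Omega> \<delta> a f"
proof -
  note K = Linf_coefficient_bound[OF a]
  note form = form_sesquilinear[OF K] form_bounded[OF K] form_coercive[OF K r(2)]
  have "\<exists>u. weak_solution \<gamma>1 \<Omega> \<delta> a f u"
    using S.lax_milgram[OF form r(1) dual_functional[OF f]] by (auto simp: weak_solution_def)
  moreover have "AE x in lborel. x \<in> E \<longrightarrow> u x = w x"
    if uw: "weak_solution \<gamma>1 \<Omega> \<delta> a f u" "weak_solution \<gamma>1 \<Omega> \<delta> a f w" for u w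
  proof -
    have V: "u \<in> space_S" "w \<in> space_S" "u - w \<in> space_S"
      using uw S.V_closed(3) by (auto simp: weak_solution_def)
    have "form a (u - w) (u - w) = 0"
      using uw V by (simp add: S.sesquilinear_left(3)[OF form(1) V(3,1,2)] weak_solution_def)
    then have "norm_S (u - w) \<le> 0 / r"
      by (intro S.coercive_bound[OF form(3) r(1) V(3)]) simp_all
    then have "norm_S (u - w) = 0" using norm_S_nonneg[of "u - w"] by simp
    from norm_S_zero_imp_AE[OF V(3) this] show ?thesis by eventually_elim simp
  qed
  ultimately show ?thesis by (auto simp: uniquely_solvable_def)
qed

text \<open>The map u is any selection of representatives of the solutions: the estimate concerns
  the seminorm of differences, which does not see the selection. The remainder bound is the
  essential supremum norm of the remainder of \<open>A\<close>, which is o(|h|) by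
  holomorphy.\<close>

lemma solution_holomorphic:
  fixes A :: "complex ^ 'n::finite \<Rightarrow> 'a \<times> 'a \<Rightarrow> complex"
  assumes A: "holomorphic_map_on Linf_S (Linf_norm (E \<times> E)) A W"
    and U: "open U" "U \<subseteq> W"
    and r: "0 < r" "\<And>\<xi>. \<xi> \<in> U \<Longrightarrow> AE p in lborel. p \<in> E \<times> E \<longrightarrow> r \<le> Re (A \<xi> p)"
    and u: "\<And>\<xi>. \<xi> \<in> U \<Longrightarrow> weak_solution \<gamma>1 \<Omega> \<delta> (A \<xi>) f (u \<xi>)"
  shows "holomorphic_map_on space_S norm_S u U"
  unfolding holomorphic_map_on_def
proof (intro conjI ballI U(1))
  have A_Linf: "A \<xi> \<in> Linf_S" if "\<xi> \<in> U" for \<xi>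
    using A U(2) that by (auto simp: holomorphic_map_on_def)
  show u_S: "u \<xi> \<in> space_S" if "\<xi> \<in> U" for \<xi>
    using u[OF that] by (simp add: weak_solution_def)
  fix z assume z: "z \<in> U"
  obtain D where D: "\<And>i. D i \<in> Linf_S"
    and lim: "((\<lambda>h. Linf_norm (E \<times> E) (\<lambda>p. A (z + h) p - A z p - (\<Sum>i\<in>UNIV. h $ i * D i p)) / norm h) \<longlongrightarrow> 0) (at 0)"
    using A U(2) z unfolding holomorphic_map_on_def by blast
  let ?R = "\<lambda>h p. A (z + h) p - A z p - (\<Sum>i\<in>UNIV. h $ i * D i p)"
  note K = Linf_coefficient_bound
  have near: "\<forall>\<^sub>F h in at 0. z + h \<in> U"
  proof (rule topological_tendstoD[OF _ U(1)])
    have "((\<lambda>h. z + h) \<longlongrightarrow> z + 0) (at 0)" by (intro tendsto_intros)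
    then show "((\<lambda>h. z + h) \<longlongrightarrow> z) (at 0)" by simp
  qed (rule z)
  have "\<exists>d. (\<forall>i. d i \<in> space_S) \<and>
    ((\<lambda>h. norm_S (u (z + h) - u z - (\<Sum>i\<in>UNIV. (\<lambda>x. h $ i * d i x))) / norm h) \<longlongrightarrow> 0) (at 0)"
  proof (rule S.solution_differentiable)
    show "sesquilinear_on (\<lambda>c u x. c * u x) space_S (form (A z))"
      by (rule form_sesquilinear[OF K[OF A_Linf[OF z]]])
    show "bounded_form_on space_S norm_S \<bar>Linf_norm (E \<times> E) (A z)\<bar> (form (A z))"
      by (rule form_bounded[OF K[OF A_Linf[OF z]]])
    show "coercive_on space_S norm_S r (form (A z))"
      by (rule form_coercive[OF K[OF A_Linf[OF z]] r(2)[OF z]])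
    show "sesquilinear_on (\<lambda>c u x. c * u x) space_S (form (D i))" for i
      by (rule form_sesquilinear[OF K[OF D]])
    show "bounded_form_on space_S norm_S \<bar>Linf_norm (E \<times> E) (D i)\<bar> (form (D i))" for i
      by (rule form_bounded[OF K[OF D]])
    show "\<forall>\<^sub>F h in at 0. sesquilinear_on (\<lambda>c u x. c * u x) space_S (form (A (z + h))) \<and>
        coercive_on space_S norm_S r (form (A (z + h)))"
      using near
    proof eventually_elim
      fix h assume h: "z + h \<in> U"
      show "sesquilinear_on (\<lambda>c u x. c * u x) space_S (form (A (z + h))) \<and>
          coercive_on space_S norm_S r (form (A (z + h)))"
        using form_sesquilinear[OF K[OF A_Linf[OF h]]]
          form_coercive[OF K[OF A_Linf[OF h]] r(2)[OF h]] by (rule conjI)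
    qed
    show "\<forall>\<^sub>F h in at 0. bounded_form_on space_S norm_S \<bar>Linf_norm (E \<times> E) (?R h)\<bar>
        (\<lambda>v w. form (A (z + h)) v w - form (A z) v w - (\<Sum>i\<in>UNIV. h $ i * form (D i) v w))"
      using near
    proof eventually_elim
      fix h assume h: "z + h \<in> U"
      note diff = Linf_space_diff[OF square_borel A_Linf[OF h] A_Linf[OF z]]
      note comb = Linf_space_lincomb(1)[OF square_borel D, where c="\<lambda>i. h $ i"]
      have "bounded_form_on space_S norm_S \<bar>Linf_norm (E \<times> E) (?R h)\<bar> (form (?R h))"
        by (rule form_bounded[OF K[OF Linf_space_diff[OF square_borel diff comb]]])
      moreover have "form (?R h) v w
          = form (A (z + h)) v w - form (A z) v w - (\<Sum>i\<in>UNIV. h $ i * form (D i) v w)"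
        if "v \<in> space_S" "w \<in> space_S" for v w
        using that by (simp only: form_diff_coefficient[OF diff comb]
            form_diff_coefficient[OF A_Linf[OF h] A_Linf[OF z]] form_lincomb_coefficient[OF D])
      ultimately show "bounded_form_on space_S norm_S \<bar>Linf_norm (E \<times> E) (?R h)\<bar>
        (\<lambda>v w. form (A (z + h)) v w - form (A z) v w - (\<Sum>i\<in>UNIV. h $ i * form (D i) v w))"
        by (simp only: bounded_form_on_def ball_triv simp_thms cong: ball_cong)
    qed
    show "((\<lambda>h. \<bar>Linf_norm (E \<times> E) (?R h)\<bar> / norm h) \<longlongrightarrow> 0) (at 0)"
      using tendsto_rabs_zero[OF lim] by (simp only: abs_divide abs_norm_cancel)
    show "\<And>v. v \<in> space_S \<Longrightarrow> form (A z) (u z) v = f v"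
      using u[OF z] by (simp add: weak_solution_def)
    show "\<forall>\<^sub>F h in at 0. u (z + h) \<in> space_S \<and> (\<forall>v\<in>space_S. form (A (z + h)) (u (z + h)) v = f v)"
      using near by eventually_elim (use u in \<open>simp add: weak_solution_def\<close>)
  qed (use r(1) u_S[OF z] in simp_all)
  \<comment> \<open>The abstract theorem adds vectors of the function type, whereas holomorphy is
    stated with pointwise sums.\<close>
  moreover have "u (z + h) - u z - (\<Sum>i\<in>UNIV. (\<lambda>x. h $ i * d i x))
      = (\<lambda>x. u (z + h) x - u z x - (\<Sum>i\<in>UNIV. h $ i * d i x))" for h and d :: "'n \<Rightarrow> 'a \<Rightarrow> complex"
  proof -
    have "(\<Sum>i\<in>I. (\<lambda>x. h $ i * d i x)) x = (\<Sum>i\<in>I. h $ i * d i x)" for I x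
      by (induction I rule: infinite_finite_induct) simp_all
    then show ?thesis by (simp add: fun_eq_iff)
  qed
  ultimately show "\<exists>d. (\<forall>i. d i \<in> space_S) \<and>
    ((\<lambda>h. norm_S (\<lambda>x. u (z + h) x - u z x - (\<Sum>i\<in>UNIV. h $ i * d i x)) / norm h) \<longlongrightarrow> 0) (at 0)"
    by simp
qed

end

section \<open>Choice of the neighbourhood of the polydisc\<close>

theorem theorem2p5:
  fixes \<Omega> :: "(real ^ 'd::finite) set"
    and D0 s \<delta> \<delta>0 rc Rc :: real
    and \<gamma>1 :: "real \<Rightarrow> real"
    and A :: "complex ^ 'n::finite \<Rightarrow> (real ^ 'd) \<times> (real ^ 'd) \<Rightarrow> complex"
    and f :: "(real ^ 'd \<Rightarrow> complex) \<Rightarrow> complex"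
  assumes "bounded_lipschitz_domain \<Omega>"
    and "kernel_profile TYPE(real ^ 'd) D0 s \<gamma>1"
    and "0 < \<delta>0" and "nonlocal_poincare \<gamma>1 \<Omega> \<delta>0"
    and "0 < \<delta>" and "\<delta> < \<delta>0"
    and "holomorphic_map_on (Linf_space (extended_square \<Omega> \<delta>)) (Linf_norm (extended_square \<Omega> \<delta>)) A UNIV"
    and "\<And>\<xi>. \<xi> \<in> real_parameters \<Longrightarrow>
           AE (x, y) in lborel. (x, y) \<in> extended_square \<Omega> \<delta> \<longrightarrow>
             A (\<chi> i. complex_of_real (\<xi> $ i)) (x, y) \<in> \<real> \<and>
             A (\<chi> i. complex_of_real (\<xi> $ i)) (x, y) = A (\<chi> i. complex_of_real (\<xi> $ i)) (y, x)"
    and "0 < rc"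
    and "\<And>\<xi>. \<xi> \<in> complex_parameters \<Longrightarrow>
           AE p in lborel. p \<in> extended_square \<Omega> \<delta> \<longrightarrow>
             rc \<le> Re (A \<xi> p) \<and> Re (A \<xi> p) \<le> cmod (A \<xi> p) \<and> cmod (A \<xi> p) \<le> Rc"
    and "f \<in> conjugate_linear_dual (nonlocal_space \<gamma>1 \<Omega> \<delta>) (nonlocal_norm \<gamma>1 \<Omega> \<delta>)"
  shows "\<exists>U. open U \<and> complex_parameters \<subseteq> U \<and>
           (\<forall>\<xi>\<in>U. uniquely_solvable \<gamma>1 \<Omega> \<delta> (A \<xi>) f) \<and>
           (\<forall>u. (\<forall>\<xi>\<in>U. weak_solution \<gamma>1 \<Omega> \<delta> (A \<xi>) f (u \<xi>)) \<longrightarrow>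
                holomorphic_map_on (nonlocal_space \<gamma>1 \<Omega> \<delta>) (nonlocal_norm \<gamma>1 \<Omega> \<delta>) u U)"
proof -
  let ?Q = "extended_square \<Omega> \<delta>"
  note A = assms(7) and f = assms(11)
  obtain C where C: "\<And>v :: real ^ 'd \<Rightarrow> real. v \<in> nonlocal_space \<gamma>1 \<Omega> \<delta> \<Longrightarrow>
      (LINT x:\<Omega>|lborel. (norm (v x))\<^sup>2) \<le> C * (nonlocal_norm \<gamma>1 \<Omega> \<delta> v)\<^sup>2"
    using assms(4,5,6) unfolding nonlocal_poincare_def by blast
  interpret nonlocal_problem \<Omega> \<gamma>1 D0 s \<delta> C
    using assms(1,2,5) C by unfold_locales (auto simp: bounded_lipschitz_domain_def)
  \<comment> \<open>Half of \<open>rc\<close> is below \<open>rc\<close>, so each point has a ball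
    on which the bound persists, and positive, so coercivity remains, with the same constant on all
    balls.\<close>
  have "\<forall>\<xi>\<in>complex_parameters. \<exists>e>0. \<forall>\<eta>\<in>ball \<xi> e. AE p in lborel. p \<in> ?Q \<longrightarrow> rc / 2 \<le> Re (A \<eta> p)"
  proof (rule ballI, rule holomorphic_Linf_lower_bound[OF square_borel A])
    fix \<xi> :: "complex ^ 'n" assume "\<xi> \<in> complex_parameters"
    from assms(10)[OF this] show "AE p in lborel. p \<in> ?Q \<longrightarrow> rc \<le> Re (A \<xi> p)"
      by eventually_elim simp
  qed (use assms(9) in simp)
  from bchoice[OF this] obtain e where e: "\<forall>\<xi>\<in>complex_parameters. 0 < e \<xi> \<and>
      (\<forall>\<eta>\<in>ball \<xi> (e \<xi>). AE p in lborel. p \<in> ?Q \<longrightarrow> rc / 2 \<le> Re (A \<eta> p))"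
    by blast
  define U where "U = (\<Union>\<xi>\<in>complex_parameters. ball \<xi> (e \<xi>))"
  have lower: "AE p in lborel. p \<in> ?Q \<longrightarrow> rc / 2 \<le> Re (A \<eta> p)" if "\<eta> \<in> U" for \<eta>
    using that e unfolding U_def by blast
  have "open U" unfolding U_def by blast
  moreover have "complex_parameters \<subseteq> U"
    unfolding U_def using e by (intro subsetI UN_I) auto
  moreover have "uniquely_solvable \<gamma>1 \<Omega> \<delta> (A \<xi>) f" if "\<xi> \<in> U" for \<xi>
    using A assms(9) lower[OF that] f
    by (intro uniquely_solvable_coercive[where r="rc / 2"]) (auto simp: holomorphic_map_on_def)
  moreover have "holomorphic_map_on (nonlocal_space \<gamma>1 \<Omega> \<delta>) (nonlocal_norm \<gamma>1 \<Omega> \<delta>) u U"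
    if "\<forall>\<xi>\<in>U. weak_solution \<gamma>1 \<Omega> \<delta> (A \<xi>) f (u \<xi>)" for u
    using A \<open>open U\<close> _ _ lower
    by (rule solution_holomorphic[where r="rc / 2"]) (use assms(9) that in auto)
  ultimately show ?thesis by blast
qed

end
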